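(* Let $\mathcal{D}=\{X\in\mathbb{R}^{n\times p}:\ \operatorname{rank}(X)\le k,\ f(\lambda(X))\le 0\}$, where $\lambda(X)$ is the vector of singular values of $X$, and let $\tilde k\le k$ be its strengthened rank. Suppose that $F^d\subseteq\operatorname{conv}(\mathcal{D})$ is a $d$-dimensional face of $\operatorname{conv}(\mathcal{D})$. Then every point of $F^d$ has rank at most $\tilde k+\lfloor\sqrt{2d+9/4}-3/2\rfloor$.
   Context: $k\le n\le p$ are positive integers; $\operatorname{conv}$ denotes convex hull. For $X\in\mathbb{R}^{n\times p}$, $\lambda(X)\in\mathbb{R}_+^n$ is the vector of its $n$ singular values. The function $f:\mathbb{R}^n\to\mathbb{R}$ is continuous, convex, symmetric (invariant under permutations of its arguments) and, since singular values are nonnegative, is taken to be sign-invariant ($f(\lambda)=f(|\lambda|)$ with $|\cdot|$ entrywise); thus $X\mapsto f(\lambda(X))$ is a continuous convex function on $\mathbb{R}^{n\times p}$. Strengthened rank: $\tilde k$ with $1\le\tilde k\le k$ is the smallest integer such that $\operatorname{conv}(\mathcal{D})=\operatorname{conv}(\{X\in\mathbb{R}^{n\times p}:\ \operatorname{rank}(X)\le\tilde k,\ f(\lambda(X))\le0\})$. A convex subset $F$ of a closed convex set $T$ is a face of $T$ if for every line segment $[a,b]\subseteq T$ with $F\cap(a,b)\ne\emptyset$ one has $[a,b]\subseteq F$. The dimension of a face is the dimension of its affine hull. *)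

theory Defs
  imports
    "HOL-Analysis.Analysis"
    "HOL-Computational_Algebra.Polynomial"
begin

text \<open>
  Vectors in \<open>\<real>\<^sup>n\<close> are \<open>real^'n\<close> and \<open>n \<times> p\<close> matrices are \<open>real^'p^'n\<close>.
  The vector \<open>s\<close> lists the singular values of \<open>X\<close> if its entries are the nonnegative square
  roots of the \<open>n\<close> eigenvalues of \<open>X X\<^sup>T\<close>, counted with multiplicity, that is, of the roots
  of its characteristic polynomial (this uses \<open>n \<le> p\<close>).  The index type carries no order, so
  the singular values are listed in an arbitrary order.
\<close>

definition lists_singular_values :: "real^'p::finite^'n::finite \<Rightarrow> real^'n \<Rightarrow> bool" where
  "lists_singular_values X s \<longleftrightarrow>
     (\<forall>i. 0 \<le> s $ i) \<and>
     (\<forall>t. det (mat t - X ** transpose X) = (\<Prod>i\<in>UNIV. t - (s $ i)\<^sup>2))"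

definition singular_values :: "real^'p::finite^'n::finite \<Rightarrow> real^'n" where
  "singular_values X = (SOME s. lists_singular_values X s)"

text \<open>
  The choice in \<open>singular_values\<close> is always from a nonempty set, and any two candidates differ
  by a permutation of the entries.
\<close>

lemma symmetric_dot:
  fixes A :: "real^'n^'n"
  assumes "transpose A = A"
  shows "x \<bullet> (A *v y) = (A *v x) \<bullet> y"
  by (metis assms dot_lmul_matrix vector_transpose_matrix)

lemma symmetric_eigenvector_exists:
  fixes A :: "real^'n^'n"
  assumes sym: "transpose A = A" and S: "subspace S" and inv: "\<And>x. x \<in> S \<Longrightarrow> A *v x \<in> S"
    and ne: "S \<noteq> {0}"
  obtains v c where "v \<in> S" "norm v = 1" "A *v v = c *\<^sub>R v"
proof -
  define K where "K = S \<inter> sphere 0 1"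
  have comp: "compact K"
    unfolding K_def by (simp add: S closed_Int_compact closed_subspace)
  obtain x where x: "x \<in> S" "x \<noteq> 0" using ne S subspace_0 by blast
  have "x /\<^sub>R norm x \<in> K" using x S by (simp add: K_def subspace_scale)
  hence "K \<noteq> {}" by blast
  moreover have "continuous_on K (\<lambda>x. x \<bullet> (A *v x))"
    by (intro continuous_intros linear_continuous_on) (simp add: linear_conv_bounded_linear[symmetric])
  ultimately obtain v where v: "v \<in> K" and max: "\<And>y. y \<in> K \<Longrightarrow> y \<bullet> (A *v y) \<le> v \<bullet> (A *v v)"
    using continuous_attains_sup[OF comp, of "\<lambda>x. x \<bullet> (A *v x)"] by blast
  define c where "c = v \<bullet> (A *v v)"
  define u where "u = A *v v - c *\<^sub>R v"
  have vS: "v \<in> S" "norm v = 1" using v by (auto simp: K_def)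
  have uS: "u \<in> S" unfolding u_def using vS S inv by (simp add: subspace_diff subspace_scale)
  have bound: "w \<bullet> (A *v w) \<le> c * (w \<bullet> w)" if "w \<in> S" for w
  proof (cases "w = 0")
    case False
    have "w /\<^sub>R norm w \<in> K" using that False S by (simp add: K_def subspace_scale)
    from max[OF this] have "(w \<bullet> (A *v w)) / (norm w)^2 \<le> c"
      by (simp add: c_def matrix_vector_mult_scaleR power2_eq_square field_simps)
    thus ?thesis using False by (simp add: field_simps power2_norm_eq_inner)
  qed simp
  define M where "M = c * (u \<bullet> u) - u \<bullet> (A *v u)"
  have key: "2 * t * (u \<bullet> u) \<le> t^2 * M" for t
  proof -
    have "v + t *\<^sub>R u \<in> S" using vS uS S by (simp add: subspace_add subspace_scale)
    from bound[OF this]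
    have le: "c + 2 * t * (u \<bullet> (A *v v)) + t^2 * (u \<bullet> (A *v u)) \<le> c * (v \<bullet> v) + 2 * t * c * (u \<bullet> v) + t^2 * c * (u \<bullet> u)"
      using symmetric_dot[OF sym, of v u]
      by (simp add: c_def inner_add_left inner_add_right matrix_vector_right_distrib
          matrix_vector_mult_scaleR algebra_simps power2_eq_square inner_commute)
    have vv: "v \<bullet> v = 1" using vS by (simp add: dot_square_norm)
    have "u \<bullet> u = u \<bullet> (A *v v) - c * (u \<bullet> v)" 
      by (subst (2) u_def) (simp add: inner_diff_right)
    hence uu: "2 * t * (u \<bullet> u) = 2 * t * (u \<bullet> (A *v v)) - 2 * t * c * (u \<bullet> v)"
      by (simp only: right_diff_distrib mult.assoc)
    show ?thesis
      unfolding uu M_def using le vv by (simp add: right_diff_distrib mult.assoc)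
  qed
  have "u \<bullet> u = 0"
  proof (rule ccontr)
    assume "u \<bullet> u \<noteq> 0"
    hence pos: "u \<bullet> u > 0" by simp
    define t where "t = (u \<bullet> u) / (\<bar>M\<bar> + 1)"
    have tp: "t > 0" using pos by (simp add: t_def add_nonneg_pos)
    have "t^2 * M = t * (t * M)" by (simp add: power2_eq_square)
    with key[of t] tp have "2 * (u \<bullet> u) \<le> t * M"
      by (metis mult.assoc mult.left_commute mult_le_cancel_left_pos)
    also have "\<dots> \<le> t * (\<bar>M\<bar> + 1)" using tp by (intro mult_left_mono) auto
    also have "\<dots> = u \<bullet> u" by (simp add: t_def)
    finally show False using pos by simp
  qed
  hence "A *v v = c *\<^sub>R v" by (simp add: u_def)
  with vS that show ?thesis by blast
qed

lemma symmetric_matrix_diagonalizable: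
  fixes A :: "real^'n^'n"
  assumes sym: "transpose A = A"
  obtains Q d where "orthogonal_matrix Q" "A ** Q = Q ** (\<chi> i j. if i = j then d i else 0)"
proof -
  define P where "P B \<longleftrightarrow> pairwise orthogonal B \<and> (\<forall>b\<in>B. norm b = 1 \<and> (\<exists>c. A *v b = c *\<^sub>R b))" 
    for B :: "(real^'n) set"
  have indep: "independent B" if "P B" for B
    using that unfolding P_def by (intro pairwise_orthogonal_independent) auto
  have card_le: "finite B \<and> card B \<le> CARD('n)" if "P B" for B
    using independent_bound[OF indep[OF that]] by simp
  have "P {}" by (simp add: P_def)
  moreover have "\<forall>B. P B \<longrightarrow> card B < CARD('n) + 1" using card_le by fastforce
  ultimately have "\<exists>B. P B \<and> (\<forall>C. P C \<longrightarrow> card C \<le> card B)" by (rule ex_has_greatest_nat)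
  then obtain B where B: "P B" and maxB: "\<And>C. P C \<Longrightarrow> card C \<le> card B"
    by blast
  define S where "S = {x. \<forall>b\<in>B. orthogonal x b}"
  have subS: "subspace S"
    by (auto simp: S_def subspace_def orthogonal_clauses)
  have "S = {0}"
  proof (rule ccontr)
    assume "S \<noteq> {0}"
    moreover have "A *v x \<in> S" if "x \<in> S" for x
      unfolding S_def
    proof safe
      fix b assume b: "b \<in> B"
      obtain c where "A *v b = c *\<^sub>R b" using B b by (auto simp: P_def)
      thus "orthogonal (A *v x) b"
        using that b symmetric_dot[OF sym, of x b] by (auto simp: orthogonal_def S_def)
    qed
    ultimately obtain v c where v: "v \<in> S" "norm v = 1" "A *v v = c *\<^sub>R v"
      using symmetric_eigenvector_exists[OF sym subS] by metis
    have "v \<notin> B" using v by (auto simp: S_def orthogonal_def)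
    moreover have "P (insert v B)"
      using B v by (auto simp: P_def pairwise_insert S_def orthogonal_commute)
    ultimately show False using maxB[of "insert v B"] card_le[OF B] by simp
  qed
  have "span B = UNIV"
  proof (rule ccontr)
    assume "span B \<noteq> UNIV"
    hence "span B \<subset> span UNIV" by (simp add: psubset_eq)
    then obtain x where "x \<noteq> 0" "\<And>y. y \<in> span B \<Longrightarrow> orthogonal x y"
      using orthogonal_to_subspace_exists_gen[of B UNIV] by blast
    hence "x \<in> S" by (auto simp: S_def span_base)
    with \<open>S = {0}\<close> \<open>x \<noteq> 0\<close> show False by simp
  qed
  hence "card B = CARD('n)"
    using dim_eq_card_independent[OF indep[OF B]] dim_span[of B] by simp
  then obtain b where b: "bij_betw b (UNIV :: 'n set) B"
    using finite_same_card_bij[of "UNIV :: 'n set" B] card_le[OF B] by auto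
  have bB: "b i \<in> B" for i using b by (auto simp: bij_betw_def)
  have "\<forall>i. \<exists>c. A *v b i = c *\<^sub>R b i" using B bB by (auto simp: P_def)
  then obtain d where d: "\<And>i. A *v b i = d i *\<^sub>R b i" by metis
  define Q :: "real^'n^'n" where "Q = (\<chi> i j. b j $ i)"
  have colQ: "column j Q = b j" for j by (simp add: Q_def column_def vec_eq_iff)
  have inner_b: "b i \<bullet> b j = (if i = j then 1 else 0)" for i j
  proof (cases "i = j")
    case True thus ?thesis using B bB[of i] by (auto simp: P_def dot_square_norm)
  next
    case False
    hence "b i \<noteq> b j" using b by (auto simp: bij_betw_def inj_on_def)
    thus ?thesis using B bB False by (auto simp: P_def pairwise_def orthogonal_def)
  qed
  have "transpose Q ** Q = mat 1"
    using inner_b by (simp add: vec_eq_iff matrix_matrix_mult_def transpose_def Q_def mat_def inner_vec_def)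
  hence "orthogonal_matrix Q" by (simp add: orthogonal_matrix)
  moreover have "A ** Q = Q ** (\<chi> i j. if i = j then d i else 0)"
  proof -
    have "(A ** Q) $ i $ j = (Q ** (\<chi> i j. if i = j then d i else 0)) $ i $ j" for i j
    proof -
      have "(A ** Q) $ i $ j = (A *v b j) $ i"
        by (simp add: matrix_matrix_mult_def matrix_vector_mult_def Q_def)
      also have "\<dots> = d j * b j $ i" by (simp add: d)
      also have "\<dots> = (Q ** (\<chi> i j. if i = j then d i else 0)) $ i $ j"
        by (simp add: matrix_matrix_mult_def Q_def if_distrib sum.delta cong: if_cong)
      finally show ?thesis .
    qed
    thus ?thesis by (simp add: vec_eq_iff)
  qed
  ultimately show ?thesis using that by blast
qed

lemma lists_singular_values_exists:
  fixes X :: "real^'p::finite^'n::finite"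
  obtains s where "lists_singular_values X s"
proof -
  define A where "A = X ** transpose X"
  have sym: "transpose A = A" by (simp add: A_def matrix_transpose_mul)
  obtain Q d where Q: "orthogonal_matrix Q" and AQ: "A ** Q = Q ** (\<chi> i j. if i = j then d i else 0)"
    by (rule symmetric_matrix_diagonalizable[OF sym])
  let ?D = "(\<chi> i j. if i = j then d i else 0) :: real^'n^'n"
  have nonneg: "d i \<ge> 0" for i
  proof -
    have "(A *v column i Q) $ k = d i * Q $ k $ i" for k
    proof -
      have "(A *v column i Q) $ k = (A ** Q) $ k $ i"
        by (simp add: matrix_matrix_mult_def matrix_vector_mult_def column_def)
      also have "\<dots> = d i * Q $ k $ i"
        unfolding AQ by (simp add: matrix_matrix_mult_def if_distrib sum.delta cong: if_cong)
      finally show ?thesis .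
    qed
    hence eig: "A *v column i Q = d i *\<^sub>R column i Q"
      by (simp add: vec_eq_iff column_def)
    have n1: "norm (column i Q) = 1"
      using Q by (simp add: orthogonal_matrix_orthonormal_columns)
    have "d i = column i Q \<bullet> (A *v column i Q)"
      by (simp add: eig n1 dot_square_norm)
    also have "\<dots> = (transpose X *v column i Q) \<bullet> (transpose X *v column i Q)"
      by (simp only: A_def matrix_vector_mul_assoc[symmetric] dot_lmul_matrix[symmetric] transpose_matrix_vector)
    finally show ?thesis by simp
  qed
  have distrib: "B ** (C - D) ** E = B ** C ** E - B ** D ** E" for B C D E :: "real^'n^'n"
    by (simp add: vec_eq_iff matrix_matrix_mult_def sum_subtractf left_diff_distrib right_diff_distrib)
  have "det (mat t - A) = (\<Prod>i\<in>UNIV. t - d i)" for t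
  proof -
    have QQ: "Q ** transpose Q = mat 1" "transpose Q ** Q = mat 1" using Q by (auto simp: orthogonal_matrix_def)
    have "A = A ** (Q ** transpose Q)" by (simp add: QQ)
    also have "\<dots> = Q ** ?D ** transpose Q" by (metis AQ matrix_mul_assoc)
    finally have A: "A = Q ** ?D ** transpose Q" .
    have mt: "Q ** mat t = t *\<^sub>R Q"
      by (simp add: vec_eq_iff matrix_matrix_mult_def mat_def if_distrib sum.delta cong: if_cong)
    have "Q ** mat t ** transpose Q = t *\<^sub>R (Q ** transpose Q)"
      unfolding mt by (simp add: vec_eq_iff matrix_matrix_mult_def sum_distrib_left mult.assoc)
    hence "mat t = Q ** mat t ** transpose Q"
      unfolding QQ by (simp add: vec_eq_iff mat_def)
    with A have "mat t - A = Q ** mat t ** transpose Q - Q ** ?D ** transpose Q"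
      by argo
    also have "\<dots> = Q ** (mat t - ?D) ** transpose Q"
      using distrib[of Q "mat t" ?D "transpose Q"] by simp
    finally have "mat t - A = Q ** (mat t - ?D) ** transpose Q" .
    hence "det (mat t - A) = det (mat t - ?D) * (det Q * det (transpose Q))"
      by (simp add: det_mul)
    also have "det Q * det (transpose Q) = 1" by (metis QQ(1) det_I det_mul)
    also have "det (mat t - ?D) = (\<Prod>i\<in>UNIV. t - d i)"
      by (subst det_diagonal) (auto simp: mat_def)
    finally show ?thesis by simp
  qed
  hence "lists_singular_values X (\<chi> i. sqrt (d i))"
    by (simp add: lists_singular_values_def A_def nonneg)
  thus ?thesis using that by blast
qed

lemma lists_singular_values_singular_values: "lists_singular_values X (singular_values X)"
  unfolding singular_values_def by (metis lists_singular_values_exists someI_ex)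

lemma lists_singular_values_unique:
  fixes X :: "real^'p::finite^'n::finite"
  assumes s: "lists_singular_values X s" and s': "lists_singular_values X s'"
  obtains \<pi> where "\<pi> permutes UNIV" "s = (\<chi> i. s' $ \<pi> i)"
proof -
  define P :: "real^'n \<Rightarrow> real poly" where "P x = (\<Prod>i\<in>UNIV. [:- ((x $ i)\<^sup>2), 1:])" for x
  have "poly (P s) t = poly (P s') t" for t
    using s s' by (simp add: P_def poly_prod lists_singular_values_def)
  hence "P s = P s'" using poly_eq_poly_eq_iff by blast
  moreover have "proots (P x) = image_mset (\<lambda>i. (x $ i)\<^sup>2) (mset_set UNIV)" for x
    unfolding P_def by (subst proots_prod) (auto simp: sum_unfold_sum_mset image_mset.compositionality o_def)
  ultimately have "image_mset (\<lambda>i. (s $ i)\<^sup>2) (mset_set UNIV) = image_mset (\<lambda>i. (s' $ i)\<^sup>2) (mset_set UNIV)"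
    by metis
  then obtain \<pi> where \<pi>: "\<pi> permutes UNIV" "\<forall>i\<in>UNIV. (s $ i)\<^sup>2 = (s' $ \<pi> i)\<^sup>2"
    by (rule image_mset_eq_implies_permutes[OF finite])
  hence "s $ i = s' $ \<pi> i" for i
    using s s' by (auto simp: lists_singular_values_def intro: power2_eq_imp_eq)
  with \<pi>(1) that show ?thesis by (metis vec_lambda_unique)
qed

definition symmetric_fun :: "(real^'n::finite \<Rightarrow> real) \<Rightarrow> bool" where
  "symmetric_fun f \<longleftrightarrow> (\<forall>\<pi> x. \<pi> permutes UNIV \<longrightarrow> f (\<chi> i. x $ \<pi> i) = f x)"

lemma symmetric_fun_singular_values:
  assumes "symmetric_fun f" and "lists_singular_values X s"
  shows "f (singular_values X) = f s"
  using lists_singular_values_unique[OF lists_singular_values_singular_values[of X] assms(2)] assms(1)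
  unfolding symmetric_fun_def by metis

definition sign_invariant :: "(real^'n::finite \<Rightarrow> real) \<Rightarrow> bool" where
  "sign_invariant f \<longleftrightarrow> (\<forall>x. f (\<chi> i. \<bar>x $ i\<bar>) = f x)"

definition spectral_rank_set :: "(real^'n::finite \<Rightarrow> real) \<Rightarrow> nat \<Rightarrow> (real^'p::finite^'n) set" where
  "spectral_rank_set f k = {X. rank X \<le> k \<and> f (singular_values X) \<le> 0}"

text \<open>The first argument only fixes the number of columns.\<close>

definition strengthened_rank :: "'p::finite itself \<Rightarrow> (real^'n::finite \<Rightarrow> real) \<Rightarrow> nat \<Rightarrow> nat" where
  "strengthened_rank _ f k =
     (LEAST j. 1 \<le> j \<and> j \<le> k \<and>
        convex hull (spectral_rank_set f k :: (real^'p^'n) set) =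
        convex hull (spectral_rank_set f j))"

end

theory Submission
  imports Defs
begin

text \<open>
Let \<open>C\<close> be the convex hull of the matrices of rank at most \<open>k\<close> with \<open>f \<le> 0\<close> at their singular values,
and let \<open>X = \<Sum>i. s\<^sub>i u\<^sub>i v\<^sub>i\<^sup>T\<close> be a singular value decomposition.  Membership of \<open>X\<close> in \<open>C\<close> is a
majorization statement about \<open>s\<close>: there must be a profile \<open>x\<^sub>0 \<ge> x\<^sub>1 \<ge> \<dots> \<ge> 0\<close> with \<open>x\<^sub>j = 0\<close> for
\<open>j \<ge> k\<close> and \<open>f x \<le> 0\<close> such that for every set \<open>K\<close> of indices the sum of \<open>s\<close> over \<open>K\<close> is at most
\<open>S(\<bar>K\<bar>)\<close>, the sum of the \<open>\<bar>K\<bar>\<close> first entries of \<open>x\<close>.  Necessity (\<open>hull_dominated\<close>) is the convexity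
of the Ky Fan norms together with that of \<open>f\<close>; sufficiency (\<open>rank_one_sum_in_hull\<close>) separates \<open>s\<close> from
the signed rearrangements of \<open>x\<close> and sums by parts.

Now let \<open>rank X = k + r\<close> with \<open>r > 0\<close>, and let \<open>I\<close> be a largest set with fewer than \<open>k\<close> elements whose
inequality is tight; the empty set is one candidate.  Because \<open>x\<close> vanishes from position \<open>k\<close> on, the
inequalities for all sizes strictly between \<open>\<bar>I\<bar>\<close> and \<open>k + r\<close> are strict, and the singular values
indexed by \<open>I\<close> are strictly larger than all others (\<open>obtain_tight_set\<close>).  At least \<open>r + 1\<close> indices
of positive singular values remain outside \<open>I\<close>; let \<open>B\<close> be their set.  A small symmetric
perturbation with trace zero of the block \<open>B\<close> of \<open>diag(s)\<close> leaves \<open>X\<close> in \<open>C\<close>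
(\<open>perturbed_in_hull\<close>): sums of at most \<open>\<bar>I\<bar>\<close> singular values are still controlled by the untouched
indices in \<open>I\<close>, the strict inequalities survive, and the total sum is a trace, because the
perturbed block is still positive definite.

So every such direction can be followed from \<open>X\<close> both ways inside \<open>C\<close>, and hence lies in the direction
space of any face that contains \<open>X\<close>.  Symmetric matrices of order \<open>b \<ge> r + 1\<close> with trace zero form a
space of dimension \<open>b (b + 1) / 2 - 1\<close>, so \<open>(r + 1) (r + 2) / 2 - 1 \<le> d\<close>
(\<open>face_dimension_lower_bound\<close>), which solved for \<open>r\<close> is the claimed bound.  The argument works for every
\<open>k\<close> that produces the same hull \<open>C\<close>, in particular for the strengthened rank.
\<close>

section \<open>Orthonormal families and sums of rank-one matrices\<close>

definition orthonormal_family :: "('i \<Rightarrow> 'a::real_inner) \<Rightarrow> bool" where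
  "orthonormal_family u \<longleftrightarrow> (\<forall>i j. u i \<bullet> u j = (if i = j then 1 else 0))"

text \<open>
With orthonormal \<open>u\<close> and \<open>v\<close> this is a singular value decomposition up to signs, and
\<open>rank_one_sum u u s\<close> is a spectral decomposition.
\<close>

definition rank_one_sum ::
  "('n \<Rightarrow> real^'m::finite) \<Rightarrow> ('n \<Rightarrow> real^'p::finite) \<Rightarrow> real^'n::finite \<Rightarrow> real^'p^'m" where
  "rank_one_sum u v s = (\<chi> a b. \<Sum>i\<in>UNIV. s $ i * u i $ a * v i $ b)"

lemma orthonormal_familyD:
  "orthonormal_family u \<Longrightarrow> u i \<bullet> u j = (if i = j then 1 else 0)"
  by (simp add: orthonormal_family_def)

lemma rank_one_sum_mult_vector: "rank_one_sum u v s *v y = (\<Sum>i\<in>UNIV. (s $ i * (v i \<bullet> y)) *\<^sub>R u i)"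
proof -
  have "(rank_one_sum u v s *v y) $ a = (\<Sum>i\<in>UNIV. (s $ i * (v i \<bullet> y)) *\<^sub>R u i) $ a" for a
  proof -
    have "(rank_one_sum u v s *v y) $ a = (\<Sum>b\<in>UNIV. \<Sum>i\<in>UNIV. s $ i * u i $ a * v i $ b * y $ b)"
      by (simp add: rank_one_sum_def matrix_vector_mult_def sum_distrib_right)
    also have "\<dots> = (\<Sum>i\<in>UNIV. \<Sum>b\<in>UNIV. s $ i * u i $ a * v i $ b * y $ b)"
      by (rule sum.swap)
    also have "\<dots> = (\<Sum>i\<in>UNIV. (s $ i * (v i \<bullet> y)) *\<^sub>R u i) $ a"
      by (simp add: inner_vec_def sum_distrib_left sum_distrib_right mult_ac)
    finally show ?thesis .
  qed
  thus ?thesis by (simp add: vec_eq_iff)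
qed

lemma inner_rank_one_sum_mult:
  "a \<bullet> (rank_one_sum u v s *v b) = (\<Sum>i\<in>UNIV. s $ i * ((u i \<bullet> a) * (v i \<bullet> b)))"
  by (simp add: rank_one_sum_mult_vector inner_sum_right mult_ac inner_commute)

lemma orthonormal_family_diagonal:
  assumes "orthonormal_family u" "orthonormal_family v"
  shows "u i \<bullet> (rank_one_sum u v s *v v i) = s $ i"
  unfolding inner_rank_one_sum_mult
  by (simp add: orthonormal_familyD[OF assms(1)] orthonormal_familyD[OF assms(2)] sum.delta if_distrib cong: if_cong)

lemma rank_one_sum_mult_basis:
  assumes "orthonormal_family v"
  shows "rank_one_sum u v s *v v i = s $ i *\<^sub>R u i"
proof -
  have "(s $ j * (v j \<bullet> v i)) *\<^sub>R u j = (if j = i then s $ i *\<^sub>R u i else 0)" for j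
    by (simp add: orthonormal_familyD[OF assms])
  thus ?thesis unfolding rank_one_sum_mult_vector by simp
qed

text \<open>
This turns a spectral decomposition of \<open>H\<close> into a singular value decomposition of \<open>H ** J\<close> when \<open>J\<close> is
a coisometry.
\<close>

lemma rank_one_sum_mult_matrix: "rank_one_sum u v s ** J = rank_one_sum u (\<lambda>i. transpose J *v v i) s"
proof -
  have "(rank_one_sum u v s ** J) $ a $ b = rank_one_sum u (\<lambda>i. transpose J *v v i) s $ a $ b" for a b
  proof -
    have "(rank_one_sum u v s ** J) $ a $ b = (\<Sum>c\<in>UNIV. \<Sum>i\<in>UNIV. s $ i * u i $ a * v i $ c * J $ c $ b)"
      by (simp add: rank_one_sum_def matrix_matrix_mult_def sum_distrib_right)
    also have "\<dots> = (\<Sum>i\<in>UNIV. \<Sum>c\<in>UNIV. s $ i * u i $ a * v i $ c * J $ c $ b)"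
      by (rule sum.swap)
    also have "\<dots> = rank_one_sum u (\<lambda>i. transpose J *v v i) s $ a $ b"
      by (simp add: rank_one_sum_def matrix_vector_mult_def transpose_def sum_distrib_left mult_ac)
    finally show ?thesis .
  qed
  thus ?thesis by (simp add: vec_eq_iff)
qed

lemma transpose_rank_one_sum: "transpose (rank_one_sum u v s) = rank_one_sum v u s"
  by (simp add: transpose_def rank_one_sum_def vec_eq_iff mult_ac)

lemma linear_rank_one_sum: "linear (rank_one_sum u v)"
  by (rule linearI) (simp_all add: rank_one_sum_def vec_eq_iff sum.distrib sum_distrib_left algebra_simps)

text \<open>
The matrix with columns \<open>u i\<close> is square, so its transpose, a left inverse, is also a right inverse.
\<close>

lemma orthonormal_family_completeness:
  fixes u :: "'n::finite \<Rightarrow> real^'n"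
  assumes "orthonormal_family u"
  shows "(\<Sum>i\<in>UNIV. u i $ a * u i $ b) = (if a = b then 1 else 0)"
proof -
  define Q :: "real^'n^'n" where "Q = (\<chi> a i. u i $ a)"
  have "transpose Q ** Q = mat 1"
    using orthonormal_familyD[OF assms]
    by (simp add: vec_eq_iff matrix_matrix_mult_def transpose_def Q_def mat_def inner_vec_def)
  hence "Q ** transpose Q = mat 1" using matrix_left_right_inverse by blast
  thus ?thesis
    by (auto simp add: vec_eq_iff matrix_matrix_mult_def transpose_def Q_def mat_def)
qed

lemma orthonormal_family_expand:
  fixes u :: "'n::finite \<Rightarrow> real^'n"
  assumes "orthonormal_family u"
  shows "(\<Sum>i\<in>UNIV. (u i \<bullet> y) *\<^sub>R u i) = y"
proof -
  have "(\<Sum>i\<in>UNIV. (u i \<bullet> y) *\<^sub>R u i) $ a = y $ a" for a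
  proof -
    have "(\<Sum>i\<in>UNIV. (u i \<bullet> y) *\<^sub>R u i) $ a = (\<Sum>i\<in>UNIV. \<Sum>b\<in>UNIV. y $ b * (u i $ a * u i $ b))"
      by (simp add: inner_vec_def sum_distrib_right sum_distrib_left mult_ac)
    also have "\<dots> = (\<Sum>b\<in>UNIV. \<Sum>i\<in>UNIV. y $ b * (u i $ a * u i $ b))"
      by (rule sum.swap)
    also have "\<dots> = (\<Sum>b\<in>UNIV. y $ b * (if a = b then 1 else 0))"
      by (simp only: sum_distrib_left[symmetric] orthonormal_family_completeness[OF assms])
    also have "\<dots> = y $ a" by (simp add: if_distrib sum.delta cong: if_cong)
    finally show ?thesis .
  qed
  thus ?thesis by (simp add: vec_eq_iff)
qed

lemma orthonormal_family_parseval: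
  fixes u :: "'n::finite \<Rightarrow> real^'n"
  assumes "orthonormal_family u"
  shows "(\<Sum>i\<in>UNIV. (u i \<bullet> y)\<^sup>2) = y \<bullet> y"
proof -
  have "y \<bullet> y = y \<bullet> (\<Sum>i\<in>UNIV. (u i \<bullet> y) *\<^sub>R u i)"
    by (simp add: orthonormal_family_expand[OF assms])
  thus ?thesis by (simp add: inner_sum_right power2_eq_square inner_commute)
qed

text \<open>
Expand \<open>(a - z) \<bullet> (a - z) \<ge> 0\<close>, where \<open>z\<close> is the projection of \<open>a\<close> to the span of the vectors from \<open>K\<close>.
\<close>

lemma bessel_inequality:
  assumes "orthonormal_family w" "finite K"
  shows "(\<Sum>q\<in>K. (w q \<bullet> a)\<^sup>2) \<le> a \<bullet> a"
proof -
  define z where "z = (\<Sum>q\<in>K. (w q \<bullet> a) *\<^sub>R w q)"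
  have za: "z \<bullet> a = (\<Sum>q\<in>K. (w q \<bullet> a)\<^sup>2)"
    by (simp add: z_def inner_sum_left power2_eq_square)
  have "w q \<bullet> z = w q \<bullet> a" if "q \<in> K" for q
    using that assms by (simp add: z_def inner_sum_right orthonormal_familyD if_distrib sum.delta cong: if_cong)
  hence "z \<bullet> z = (\<Sum>q\<in>K. (w q \<bullet> a)\<^sup>2)"
    by (subst z_def) (simp add: inner_sum_left power2_eq_square)
  moreover have "0 \<le> (a - z) \<bullet> (a - z)" by simp
  ultimately show ?thesis using za
    by (simp add: inner_diff_left inner_diff_right inner_commute)
qed

lemma orthonormal_family_resolution_of_identity:
  fixes u :: "'n::finite \<Rightarrow> real^'n"
  assumes "orthonormal_family u"
  shows "rank_one_sum u u 1 = mat 1"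
  using orthonormal_family_completeness[OF assms]
  by (auto simp add: rank_one_sum_def mat_def vec_eq_iff)

lemma orthonormal_family_trace:
  fixes u :: "'n::finite \<Rightarrow> real^'m::finite"
  assumes "orthonormal_family u"
  shows "trace (rank_one_sum u u s) = (\<Sum>i\<in>UNIV. s $ i)"
proof -
  have "trace (rank_one_sum u u s) = (\<Sum>i\<in>UNIV. \<Sum>a\<in>UNIV. s $ i * u i $ a * u i $ a)"
    unfolding trace_def rank_one_sum_def vec_lambda_beta by (rule sum.swap)
  also have "\<dots> = (\<Sum>i\<in>UNIV. s $ i * (u i \<bullet> u i))"
    by (simp add: inner_vec_def sum_distrib_left mult_ac)
  finally show ?thesis by (simp add: orthonormal_familyD[OF assms])
qed

lemma orthonormal_family_independent:
  assumes "orthonormal_family u"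
  shows "inj u" and "independent (u ` A)"
proof -
  have *: "u i = u j \<Longrightarrow> i = j" for i j
    using orthonormal_familyD[OF assms, of i j] orthonormal_familyD[OF assms, of j j]
    by (metis zero_neq_one)
  thus "inj u" by (rule injI)
  have "u i \<noteq> 0" for i using orthonormal_familyD[OF assms, of i i] by auto
  moreover have "pairwise orthogonal (u ` A)"
    using orthonormal_familyD[OF assms] by (auto simp: pairwise_def orthogonal_def)
  ultimately show "independent (u ` A)" by (intro pairwise_orthogonal_independent) auto
qed

text \<open>
The range is spanned by the \<open>u i\<close> with nonzero coefficient.
\<close>

lemma rank_rank_one_sum:
  fixes u :: "'n::finite \<Rightarrow> real^'m::finite" and v :: "'n \<Rightarrow> real^'p::finite"
  assumes u: "orthonormal_family u" and v: "orthonormal_family v"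
  shows "rank (rank_one_sum u v s) = card {i. s $ i \<noteq> 0}"
proof -
  let ?P = "{i. s $ i \<noteq> 0}"
  have "range (\<lambda>y. rank_one_sum u v s *v y) = span (u ` ?P)"
  proof
    show "range (\<lambda>y. rank_one_sum u v s *v y) \<subseteq> span (u ` ?P)"
    proof clarify
      fix y
      show "rank_one_sum u v s *v y \<in> span (u ` ?P)" unfolding rank_one_sum_mult_vector
      proof (rule span_sum)
        fix i show "(s $ i * (v i \<bullet> y)) *\<^sub>R u i \<in> span (u ` ?P)"
          by (cases "s $ i = 0") (auto intro: span_scale span_base simp: span_zero)
      qed
    qed
    have "u i \<in> range (\<lambda>y. rank_one_sum u v s *v y)" if "s $ i \<noteq> 0" for i
    proof -
      have "u i = rank_one_sum u v s *v ((1 / s $ i) *\<^sub>R v i)"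
        using that by (simp add: matrix_vector_mult_scaleR rank_one_sum_mult_basis[OF v])
      thus ?thesis by blast
    qed
    moreover have "subspace (range (\<lambda>y. rank_one_sum u v s *v y))"
      by (intro linear_subspace_image subspace_UNIV matrix_vector_mul_linear)
    ultimately show "span (u ` ?P) \<subseteq> range (\<lambda>y. rank_one_sum u v s *v y)"
      by (intro span_minimal) auto
  qed
  hence "rank (rank_one_sum u v s) = dim (u ` ?P)" by (simp add: rank_dim_range)
  also have "\<dots> = card (u ` ?P)"
    by (rule dim_eq_card_independent[OF orthonormal_family_independent(2)[OF u]])
  also have "\<dots> = card ?P"
    by (rule card_image[OF inj_on_subset[OF orthonormal_family_independent(1)[OF u]]]) simp
  finally show ?thesis .
qed

section \<open>Spectral and singular value decompositions\<close>

lemma spectral_decomposition: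
  fixes H :: "real^'n::finite^'n"
  assumes sym: "transpose H = H"
  obtains w :: "'n \<Rightarrow> real^'n" and \<mu> :: "real^'n" where "orthonormal_family w" "H = rank_one_sum w w \<mu>"
proof -
  obtain Q d where Q: "orthogonal_matrix Q" and HQ: "H ** Q = Q ** (\<chi> i j. if i = j then d i else 0)"
    by (rule symmetric_matrix_diagonalizable[OF sym])
  define w where "w i = column i Q" for i
  have w: "orthonormal_family w"
    using Q by (auto simp: orthogonal_matrix_orthonormal_columns orthonormal_family_def w_def
        dot_square_norm orthogonal_def)
  have eig: "H *v w i = d i *\<^sub>R w i" for i
  proof -
    have "(H *v w i) $ k = (H ** Q) $ k $ i" for k
      by (simp add: matrix_matrix_mult_def matrix_vector_mult_def column_def w_def)
    thus ?thesis unfolding HQ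
      by (simp add: vec_eq_iff column_def w_def matrix_matrix_mult_def if_distrib sum.delta cong: if_cong)
  qed
  have "H *v y = rank_one_sum w w (\<chi> i. d i) *v y" for y
  proof -
    have "H *v y = H *v (\<Sum>i\<in>UNIV. (w i \<bullet> y) *\<^sub>R w i)"
      by (simp add: orthonormal_family_expand[OF w])
    also have "\<dots> = (\<Sum>i\<in>UNIV. (w i \<bullet> y) *\<^sub>R (H *v w i))"
      by (simp add: linear_sum[OF matrix_vector_mul_linear] matrix_vector_mult_scaleR)
    finally show ?thesis by (simp add: eig rank_one_sum_mult_vector mult_ac)
  qed
  hence "H = rank_one_sum w w (\<chi> i. d i)" by (simp add: matrix_eq)
  with w that show ?thesis by blast
qed

lemma rank_one_sum_gram:
  assumes "orthonormal_family v"
  shows "rank_one_sum u v s ** transpose (rank_one_sum u v s) = rank_one_sum u u (\<chi> i. (s $ i)\<^sup>2)"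
proof -
  have "transpose (transpose (rank_one_sum u v s)) *v v i = s $ i *\<^sub>R u i" for i
    by (simp only: transpose_transpose rank_one_sum_mult_basis[OF assms])
  hence "rank_one_sum u v s ** transpose (rank_one_sum u v s) = rank_one_sum u (\<lambda>i. s $ i *\<^sub>R u i) s"
    by (simp add: rank_one_sum_mult_matrix)
  also have "\<dots> = rank_one_sum u u (\<chi> i. (s $ i)\<^sup>2)"
    by (simp add: rank_one_sum_def power2_eq_square mult_ac)
  finally show ?thesis .
qed

text \<open>
The Gram matrix is conjugate, by the orthogonal matrix with columns \<open>u i\<close>, to the diagonal matrix of
the squares \<open>(s $ i)\<^sup>2\<close>, which gives its characteristic polynomial.
\<close>

lemma lists_singular_values_rank_one_sum:
  fixes u :: "'n::finite \<Rightarrow> real^'n" and v :: "'n \<Rightarrow> real^'p::finite"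
  assumes u: "orthonormal_family u" and v: "orthonormal_family v"
  shows "lists_singular_values (rank_one_sum u v s) (\<chi> i. \<bar>s $ i\<bar>)"
proof -
  define Q :: "real^'n^'n" where "Q = (\<chi> a i. u i $ a)"
  have QQ: "Q ** transpose Q = mat 1"
    using orthonormal_family_completeness[OF u]
    by (auto simp add: vec_eq_iff matrix_matrix_mult_def transpose_def Q_def mat_def)
  have "det (mat t - rank_one_sum u u (\<chi> i. (s $ i)\<^sup>2)) = (\<Prod>i\<in>UNIV. t - (s $ i)\<^sup>2)" for t
  proof -
    let ?D = "(\<chi> i j. if i = j then t - (s $ i)\<^sup>2 else 0) :: real^'n^'n"
    have "mat t - rank_one_sum u u (\<chi> i. (s $ i)\<^sup>2) = rank_one_sum u u (\<chi> i. t - (s $ i)\<^sup>2)"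
    proof -
      have "mat t = t *\<^sub>R (mat 1 :: real^'n^'n)" by (simp add: mat_def vec_eq_iff)
      also have "\<dots> = rank_one_sum u u (t *\<^sub>R 1)"
        by (simp only: linear_cmul[OF linear_rank_one_sum] orthonormal_family_resolution_of_identity[OF u])
      finally have "mat t - rank_one_sum u u (\<chi> i. (s $ i)\<^sup>2) = rank_one_sum u u (t *\<^sub>R 1 - (\<chi> i. (s $ i)\<^sup>2))"
        by (simp add: linear_diff[OF linear_rank_one_sum])
      also have "t *\<^sub>R 1 - (\<chi> i. (s $ i)\<^sup>2) = (\<chi> i. t - (s $ i)\<^sup>2)" by (simp add: vec_eq_iff)
      finally show ?thesis .
    qed
    also have "\<dots> = Q ** ?D ** transpose Q"
      by (simp add: rank_one_sum_def matrix_matrix_mult_def transpose_def Q_def vec_eq_iff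
          if_distrib sum.delta mult_ac cong: if_cong)
    finally have "det (mat t - rank_one_sum u u (\<chi> i. (s $ i)\<^sup>2)) = det ?D * (det Q * det (transpose Q))"
      by (simp add: det_mul)
    also have "det Q * det (transpose Q) = 1" by (metis QQ det_I det_mul)
    also have "det ?D = (\<Prod>i\<in>UNIV. t - (s $ i)\<^sup>2)"
      by (subst det_diagonal) auto
    finally show ?thesis by simp
  qed
  thus ?thesis by (simp add: lists_singular_values_def rank_one_sum_gram[OF v])
qed

text \<open>
Needed for the right singular vectors: those belonging to the singular value zero are not determined
by the matrix and have to be supplied.
\<close>

lemma orthonormal_extension_family:
  fixes v :: "'n::finite \<Rightarrow> 'a::euclidean_space"
  assumes dim: "CARD('n) \<le> DIM('a)"
    and v: "\<And>i j. i \<in> P \<Longrightarrow> j \<in> P \<Longrightarrow> v i \<bullet> v j = (if i = j then 1 else 0)"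
  obtains w where "orthonormal_family w" "\<And>i. i \<in> P \<Longrightarrow> w i = v i"
proof -
  have "\<exists>w. (\<forall>i\<in>P \<union> R. \<forall>j\<in>P \<union> R. w i \<bullet> w j = (if i = j then 1 else 0)) \<and> (\<forall>i\<in>P. w i = v i)"
    if "finite R" for R
    using that
  proof (induction R rule: finite_induct)
    case empty
    show ?case using v by (intro exI[of _ v]) auto
  next
    case (insert i R)
    then obtain w where w: "\<And>i j. i \<in> P \<union> R \<Longrightarrow> j \<in> P \<union> R \<Longrightarrow> w i \<bullet> w j = (if i = j then 1 else 0)"
      and wP: "\<And>i. i \<in> P \<Longrightarrow> w i = v i" by blast
    show ?case
    proof (cases "i \<in> P")
      case True
      hence "P \<union> insert i R = P \<union> R" by blast
      thus ?thesis using w wP by metis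
    next
      case False
      let ?S = "w ` (P \<union> R)"
      have "dim ?S \<le> card ?S" by (rule dim_le_card) (auto simp: span_superset)
      also have "\<dots> \<le> card (P \<union> R)" by (rule card_image_le) simp
      also have "\<dots> < CARD('n)" using False insert.hyps by (intro psubset_card_mono) auto
      finally have "dim ?S < DIM('a)" using dim by simp
      then obtain y where y: "y \<noteq> 0" "\<And>z. z \<in> span ?S \<Longrightarrow> orthogonal y z"
        using orthogonal_to_subspace_exists by blast
      define y' where "y' = y /\<^sub>R norm y"
      have yy: "y' \<bullet> y' = 1" using y by (simp add: y'_def dot_square_norm power2_eq_square)
      have yw: "y' \<bullet> w j = 0" "w j \<bullet> y' = 0" if "j \<in> P \<union> R" for j
        using y(2)[of "w j"] that by (auto simp: y'_def span_base orthogonal_def inner_commute)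
      have iPR: "i \<notin> P \<union> R" using False insert.hyps by auto
      show ?thesis
      proof (intro exI[of _ "w(i := y')"] conjI ballI)
        fix a b assume "a \<in> P \<union> insert i R" "b \<in> P \<union> insert i R"
        thus "(w(i := y')) a \<bullet> (w(i := y')) b = (if a = b then 1 else 0)"
          using w yy yw iPR by (cases "a = i"; cases "b = i") auto
      qed (use wP False in auto)
    qed
  qed
  from this[of UNIV] that show ?thesis by (auto simp: orthonormal_family_def)
qed

text \<open>
Diagonalize \<open>X ** transpose X\<close>, with eigenvectors \<open>u i\<close>.  The vectors \<open>transpose X *v u i\<close> are then
orthogonal; normalize the nonzero ones and extend.
\<close>

lemma singular_value_decomposition:
  fixes X :: "real^'p::finite^'n::finite"
  assumes np: "CARD('n) \<le> CARD('p)"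
  obtains u :: "'n \<Rightarrow> real^'n" and v :: "'n \<Rightarrow> real^'p" and s :: "real^'n"
    where "orthonormal_family u" "orthonormal_family v" "\<And>i. 0 \<le> s $ i"
    "X = rank_one_sum u v s"
proof -
  define A where "A = X ** transpose X"
  have sym: "transpose A = A" by (simp add: A_def matrix_transpose_mul)
  obtain u :: "'n \<Rightarrow> real^'n" and d :: "real^'n" where u: "orthonormal_family u" and Au: "A = rank_one_sum u u d"
    using sym by (rule spectral_decomposition)
  have eig: "A *v u i = d $ i *\<^sub>R u i" for i
    unfolding Au by (rule rank_one_sum_mult_basis[OF u])
  define y where "y i = transpose X *v u i" for i
  \<comment> \<open>The \<open>y i\<close> are orthogonal with squared lengths \<open>d $ i\<close>; in particular \<open>y i = 0\<close> if \<open>d $ i = 0\<close>.\<close>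
  have yy: "y i \<bullet> y j = (if i = j then d $ i else 0)" for i j
  proof -
    have "y i \<bullet> y j = u i \<bullet> (A *v u j)"
      unfolding y_def A_def
      by (simp only: matrix_vector_mul_assoc[symmetric] dot_lmul_matrix[symmetric] transpose_matrix_vector)
    thus ?thesis by (simp add: eig orthonormal_familyD[OF u])
  qed
  have d: "d $ i \<ge> 0" for i using yy[of i i] by (metis inner_ge_zero)
  obtain v where v: "orthonormal_family v" and vy: "\<And>i. i \<in> {i. d $ i > 0} \<Longrightarrow> v i = y i /\<^sub>R sqrt (d $ i)"
  proof (rule orthonormal_extension_family[of "{i. d $ i > 0}" "\<lambda>i. y i /\<^sub>R sqrt (d $ i)"])
    show "CARD('n) \<le> DIM(real^'p)" using np by simp
  qed (auto simp: yy field_simps)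
  have y: "y i = sqrt (d $ i) *\<^sub>R v i" for i
  proof (cases "d $ i = 0")
    case True
    hence "y i = 0" using yy[of i i] by simp
    thus ?thesis using True by simp
  next
    case False thus ?thesis using d[of i] vy[of i] by simp
  qed
  have "rank_one_sum u v (\<chi> i. sqrt (d $ i)) = rank_one_sum u (\<lambda>i. transpose X *v u i) 1"
    unfolding y_def[symmetric] y by (simp add: rank_one_sum_def mult_ac)
  also have "\<dots> = mat 1 ** X"
    by (simp only: rank_one_sum_mult_matrix[symmetric] orthonormal_family_resolution_of_identity[OF u])
  finally have "X = rank_one_sum u v (\<chi> i. sqrt (d $ i))" by simp
  with u v d that[of u v "\<chi> i. sqrt (d $ i)"] show ?thesis by simp
qed

section \<open>Inequalities for ordered sums\<close>

lemma obtain_decreasing_enumeration: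
  fixes c :: "'n::finite \<Rightarrow> real"
  obtains g where "bij_betw g {..<CARD('n)} UNIV"
    "\<And>i j. i \<le> j \<Longrightarrow> j < CARD('n) \<Longrightarrow> c (g j) \<le> c (g i)"
proof -
  obtain xs :: "'n list" where xs: "set xs = UNIV" "distinct xs"
    using finite_distinct_list[OF finite] by blast
  define ys where "ys = sort_key (\<lambda>a. - c a) xs"
  have ys: "set ys = UNIV" "distinct ys" "sorted (map (\<lambda>a. - c a) ys)"
    using xs by (simp_all add: ys_def)
  have len: "length ys = CARD('n)" using ys distinct_card by metis
  have "bij_betw ((!) ys) {..<CARD('n)} UNIV"
    using ys len by (intro bij_betw_nth) auto
  moreover have "c (ys ! j) \<le> c (ys ! i)" if "i \<le> j" "j < CARD('n)" for i j
    using sorted_nth_mono[OF ys(3), of i j] that len by simp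
  ultimately show ?thesis using that by blast
qed

text \<open>
Moving weight from outside \<open>K\<close> into \<open>K\<close> never decreases the sum, since \<open>\<tau>\<close> separates the values
of \<open>c\<close> on \<open>K\<close> from the others.
\<close>

lemma weighted_sum_le_top_sum:
  fixes c p :: "'a \<Rightarrow> real"
  assumes A: "finite A" "K \<subseteq> A" and \<tau>: "0 \<le> \<tau>" "\<And>a. a \<in> K \<Longrightarrow> \<tau> \<le> c a"
    "\<And>a. a \<in> A - K \<Longrightarrow> c a \<le> \<tau>"
    and p: "\<And>a. a \<in> A \<Longrightarrow> 0 \<le> p a" "\<And>a. a \<in> A \<Longrightarrow> p a \<le> 1" "sum p A \<le> card K"
  shows "(\<Sum>a\<in>A. c a * p a) \<le> sum c K"
proof -
  have "(\<Sum>a\<in>A. c a * p a) \<le> (\<Sum>a\<in>A. \<tau> * p a + (if a \<in> K then c a - \<tau> else 0))"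
  proof (rule sum_mono)
    fix a assume a: "a \<in> A"
    show "c a * p a \<le> \<tau> * p a + (if a \<in> K then c a - \<tau> else 0)"
    proof (cases "a \<in> K")
      case True
      hence "0 \<le> (c a - \<tau>) * (1 - p a)" using \<tau>(2) p(2)[OF a] by simp
      thus ?thesis using True by (simp add: algebra_simps)
    next
      case False
      thus ?thesis using a \<tau>(3) p(1)[OF a] by (simp add: mult_right_mono)
    qed
  qed
  also have "\<dots> = \<tau> * sum p A + (\<Sum>a\<in>K. c a - \<tau>)"
    using A by (simp add: sum.distrib sum_distrib_left sum.inter_restrict[symmetric] Int_absorb1)
  also have "\<dots> = \<tau> * (sum p A - card K) + sum c K"
    by (simp add: sum_subtractf algebra_simps)
  also have "\<dots> \<le> sum c K" using \<tau>(1) p(3) by (simp add: mult_nonneg_nonpos)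
  finally show ?thesis .
qed

lemma weighted_sum_le_some_sum:
  fixes c p :: "'n::finite \<Rightarrow> real"
  assumes l: "l \<le> CARD('n)" and c: "\<And>a. 0 \<le> c a"
    and p: "\<And>a. 0 \<le> p a" "\<And>a. p a \<le> 1" "sum p UNIV \<le> l"
  obtains K where "card K = l" "\<And>a b. a \<in> K \<Longrightarrow> b \<notin> K \<Longrightarrow> c b \<le> c a"
    "(\<Sum>a\<in>UNIV. c a * p a) \<le> sum c K"
proof -
  obtain g where g: "bij_betw g {..<CARD('n)} UNIV"
    and dec: "\<And>i j. i \<le> j \<Longrightarrow> j < CARD('n) \<Longrightarrow> c (g j) \<le> c (g i)"
    using obtain_decreasing_enumeration[of c] by metis
  define K where "K = g ` {..<l}"
  define \<tau> where "\<tau> = (if l < CARD('n) then c (g l) else 0)"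
  have "inj_on g {..<l}" using g l by (auto simp: bij_betw_def intro: inj_on_subset)
  hence cK: "card K = l" by (simp add: K_def card_image)
  have in_K: "\<tau> \<le> c a" if "a \<in> K" for a using that dec l c by (auto simp: K_def \<tau>_def)
  have off_K: "c a \<le> \<tau>" if "a \<notin> K" for a
  proof -
    obtain j where j: "j < CARD('n)" "a = g j" using g by (auto simp: bij_betw_def)
    with that have "l \<le> j" by (auto simp: K_def not_less[symmetric])
    thus ?thesis using j dec[of l j] by (simp add: \<tau>_def)
  qed
  have "(\<Sum>a\<in>UNIV. c a * p a) \<le> sum c K"
    using p by (intro weighted_sum_le_top_sum[where \<tau> = \<tau>] in_K off_K) (auto simp: cK \<tau>_def c)
  with that[OF cK] in_K off_K show ?thesis by (meson order_trans)
qed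

text \<open>
Summation by parts: \<open>\<Sum>j<N. d j * e j\<close> is a combination of the partial sums of \<open>e = b - a\<close> with the
nonnegative coefficients \<open>d j - d (j + 1)\<close> and \<open>d (N - 1)\<close>.
\<close>

lemma abel_inequality:
  fixes d a b :: "nat \<Rightarrow> real"
  assumes dec: "\<And>i j. i \<le> j \<Longrightarrow> j < N \<Longrightarrow> d j \<le> d i" and nonneg: "\<And>j. j < N \<Longrightarrow> 0 \<le> d j"
    and partial: "\<And>l. l \<le> N \<Longrightarrow> sum a {..<l} \<le> sum b {..<l}"
  shows "(\<Sum>j<N. d j * a j) \<le> (\<Sum>j<N. d j * b j)"
proof (cases N)
  case (Suc M)
  define e where "e j = b j - a j" for j
  have E: "0 \<le> sum e {..<l}" if "l \<le> N" for l
    using partial[OF that] by (simp add: e_def sum_subtractf)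
  have "d n * sum e {..<Suc n} \<le> (\<Sum>j<Suc n. d j * e j)" if "n < N" for n
    using that
  proof (induction n)
    case (Suc n)
    have "d (Suc n) * sum e {..<Suc n} \<le> d n * sum e {..<Suc n}"
      using dec[of n "Suc n"] E[of "Suc n"] Suc.prems by (intro mult_right_mono) auto
    also have "\<dots> \<le> (\<Sum>j<Suc n. d j * e j)" using Suc by simp
    finally show ?case by (simp add: distrib_left)
  qed simp
  from this[of M] have "d M * sum e {..<N} \<le> (\<Sum>j<N. d j * e j)" using Suc by simp
  moreover have "0 \<le> d M * sum e {..<N}" using Suc nonneg[of M] E[of N] by simp
  ultimately have "0 \<le> (\<Sum>j<N. d j * e j)" by linarith
  thus ?thesis by (simp add: e_def right_diff_distrib sum_subtractf)
qed simp

section \<open>Points of the hull are dominated by a profile\<close>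

text \<open>
A fixed listing of the unordered index type, along which decreasing sequences are turned into vectors.
\<close>

definition index_of :: "'n::finite \<Rightarrow> nat" where
  "index_of = to_nat_on UNIV"

lemma bij_betw_index_of: "bij_betw index_of (UNIV :: 'n::finite set) {..<CARD('n)}"
  unfolding index_of_def by (rule to_nat_on_finite) simp

lemma symmetric_fun_reindex:
  fixes f :: "real^'n::finite \<Rightarrow> real"
  assumes f: "symmetric_fun f" and e: "bij_betw e UNIV {..<CARD('n)}"
  shows "f (\<chi> i. x (e i)) = f (\<chi> i. x (index_of i))"
proof -
  let ?h = "index_of :: 'n \<Rightarrow> nat"
  define \<pi> where "\<pi> = inv_into UNIV ?h \<circ> e"
  have "bij \<pi>" unfolding \<pi>_def
    by (rule bij_betw_trans[OF e bij_betw_inv_into[OF bij_betw_index_of]])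
  hence "\<pi> permutes UNIV" by (intro bij_imp_permutes) auto
  hence "f (\<chi> i. (\<chi> i. x (?h i)) $ \<pi> i) = f (\<chi> i. x (?h i))"
    using f unfolding symmetric_fun_def by blast
  moreover have "?h (\<pi> i) = e i" for i
  proof -
    have "e i \<in> range ?h" using e bij_betw_index_of[where 'n='n] by (auto simp: bij_betw_def)
    thus ?thesis by (simp add: \<pi>_def f_inv_into_f)
  qed
  ultimately show ?thesis by simp
qed

text \<open>
A profile lists singular values in decreasing order, continued by zeros.  Sorting is what makes
averages of profiles again profiles with at most \<open>k\<close> nonzero entries.
\<close>

definition singular_profiles :: "(real^'n::finite \<Rightarrow> real) \<Rightarrow> nat \<Rightarrow> (nat \<Rightarrow> real) set" where
  "singular_profiles f k =
     {x. antimono x \<and> (\<forall>j. 0 \<le> x j) \<and> (\<forall>j\<ge>k. x j = 0) \<and> f (\<chi> i. x (index_of i)) \<le> 0}"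

text \<open>
The maximum of the left-hand side over \<open>u\<close>, \<open>v\<close> and all sets \<open>K\<close> of a given size is a Ky Fan norm
of \<open>X\<close>, the sum of its largest singular values.  In this bilinear form the condition is visibly convex in the pair
of \<open>X\<close> and \<open>x\<close>.
\<close>

definition ky_fan_dominated :: "real^'p::finite^'n::finite \<Rightarrow> (nat \<Rightarrow> real) \<Rightarrow> bool" where
  "ky_fan_dominated X x \<longleftrightarrow>
     (\<forall>(u :: 'n \<Rightarrow> real^'n) (v :: 'n \<Rightarrow> real^'p) K. orthonormal_family u \<longrightarrow> orthonormal_family v \<longrightarrow>
        (\<Sum>i\<in>K. u i \<bullet> (X *v v i)) \<le> sum x {..<card K})"

text \<open>
Ky Fan's inequality.  By \<open>a b \<le> (a\<^sup>2 + b\<^sup>2) / 2\<close> the bilinear sum is at most a weighted sum of the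
singular values; by Bessel's inequality, in one direction, each weight is at most 1 and, in the
other, the weights have total at most \<open>\<bar>K\<bar>\<close>.
\<close>

lemma ky_fan_dominated_rank_one_sum:
  fixes u :: "'n::finite \<Rightarrow> real^'n" and v :: "'n \<Rightarrow> real^'p::finite" and s :: "real^'n"
  assumes u: "orthonormal_family u" and v: "orthonormal_family v"
    and e: "bij_betw e UNIV {..<CARD('n)}" and s: "\<And>i. s $ i = x (e i)"
    and x: "antimono x" "\<And>j. 0 \<le> x j"
  shows "ky_fan_dominated (rank_one_sum u v s) x"
  unfolding ky_fan_dominated_def
proof (intro allI impI)
  fix u' :: "'n \<Rightarrow> real^'n" and v' :: "'n \<Rightarrow> real^'p" and K :: "'n set"
  assume u': "orthonormal_family u'" and v': "orthonormal_family v'"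
  define p where "p j = (\<Sum>i\<in>K. ((u j \<bullet> u' i)\<^sup>2 + (v j \<bullet> v' i)\<^sup>2) / 2)" for j
  let ?T = "{j. e j < card K}"
  have bes: "(\<Sum>i\<in>K. (u j \<bullet> u' i)\<^sup>2) \<le> 1" "(\<Sum>i\<in>K. (v j \<bullet> v' i)\<^sup>2) \<le> 1"
    "(\<Sum>i\<in>UNIV. (u i \<bullet> u' j)\<^sup>2) \<le> 1" "(\<Sum>i\<in>UNIV. (v i \<bullet> v' j)\<^sup>2) \<le> 1" for j
    using bessel_inequality[OF u', of K "u j"] bessel_inequality[OF v', of K "v j"]
      bessel_inequality[OF u, of UNIV "u' j"] bessel_inequality[OF v, of UNIV "v' j"]
    by (simp_all add: inner_commute orthonormal_familyD[OF u] orthonormal_familyD[OF v]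
        orthonormal_familyD[OF u'] orthonormal_familyD[OF v'])
  have "card K \<le> CARD('n)" by (intro card_mono) auto
  moreover have "e ` ?T = range e \<inter> {..<card K}" by auto
  ultimately have img: "e ` ?T = {..<card K}" using e by (auto simp: bij_betw_def)
  have inj: "inj_on e ?T" using e by (auto simp: bij_betw_def intro: inj_on_subset)
  have cardT: "card ?T = card K" using card_image[OF inj] img by simp
  have "(\<Sum>i\<in>K. u' i \<bullet> (rank_one_sum u v s *v v' i)) \<le> (\<Sum>j\<in>UNIV. s $ j * p j)"
  proof -
    have "(\<Sum>i\<in>K. u' i \<bullet> (rank_one_sum u v s *v v' i)) = (\<Sum>j\<in>UNIV. \<Sum>i\<in>K. s $ j * ((u j \<bullet> u' i) * (v j \<bullet> v' i)))"
      unfolding inner_rank_one_sum_mult by (rule sum.swap)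
    also have "\<dots> \<le> (\<Sum>j\<in>UNIV. \<Sum>i\<in>K. s $ j * (((u j \<bullet> u' i)\<^sup>2 + (v j \<bullet> v' i)\<^sup>2) / 2))"
    proof (intro sum_mono mult_left_mono)
      fix i j
      show "(u j \<bullet> u' i) * (v j \<bullet> v' i) \<le> ((u j \<bullet> u' i)\<^sup>2 + (v j \<bullet> v' i)\<^sup>2) / 2"
        using sum_squares_bound[of "u j \<bullet> u' i" "v j \<bullet> v' i"] by simp
      show "0 \<le> s $ j" by (simp add: s x)
    qed
    finally show ?thesis by (simp add: p_def sum_distrib_left)
  qed
  also have "\<dots> \<le> (\<Sum>j\<in>?T. s $ j)"
  proof (rule weighted_sum_le_top_sum)
    show "0 \<le> x (card K)" by (rule x)
    show "x (card K) \<le> s $ a" if "a \<in> ?T" for a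
      using that x(1) by (auto simp: s antimono_def)
    show "s $ a \<le> x (card K)" if "a \<in> UNIV - ?T" for a
      using that x(1) by (auto simp: s antimono_def)
    show "0 \<le> p a" for a by (auto simp: p_def intro!: sum_nonneg)
    show "p a \<le> 1" for a
      using bes(1,2)[of a] by (simp add: p_def sum.distrib sum_divide_distrib[symmetric])
    have "sum p UNIV = (\<Sum>i\<in>K. \<Sum>j\<in>UNIV. ((u j \<bullet> u' i)\<^sup>2 + (v j \<bullet> v' i)\<^sup>2) / 2)"
      unfolding p_def by (rule sum.swap)
    also have "\<dots> \<le> (\<Sum>i\<in>K. 1)"
    proof (rule sum_mono)
      fix i show "(\<Sum>j\<in>UNIV. ((u j \<bullet> u' i)\<^sup>2 + (v j \<bullet> v' i)\<^sup>2) / 2) \<le> 1"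
        using bes(3,4)[of i] by (simp add: sum.distrib sum_divide_distrib[symmetric])
    qed
    finally show "sum p UNIV \<le> card ?T" by (simp add: cardT)
  qed auto
  also have "\<dots> = sum x {..<card K}"
    unfolding img[symmetric] by (simp add: sum.reindex[OF inj] s)
  finally show "(\<Sum>i\<in>K. u' i \<bullet> (rank_one_sum u v s *v v' i)) \<le> sum x {..<card K}" .
qed

lemma spectral_rank_set_dominated:
  fixes f :: "real^'n::finite \<Rightarrow> real" and X :: "real^'p::finite^'n"
  assumes np: "CARD('n) \<le> CARD('p)" and f: "symmetric_fun f"
    and X: "X \<in> spectral_rank_set f k"
  shows "\<exists>x\<in>singular_profiles f k. ky_fan_dominated X x"
proof -
  obtain u :: "'n \<Rightarrow> real^'n" and v :: "'n \<Rightarrow> real^'p" and s :: "real^'n"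
    where u: "orthonormal_family u" and v: "orthonormal_family v" and s: "\<And>i. 0 \<le> s $ i"
      and Xe: "X = rank_one_sum u v s"
    using singular_value_decomposition[OF np, of X] by metis
  obtain g where g: "bij_betw g {..<CARD('n)} UNIV"
    and dec: "\<And>i j. i \<le> j \<Longrightarrow> j < CARD('n) \<Longrightarrow> s $ (g j) \<le> s $ (g i)"
    using obtain_decreasing_enumeration[of "\<lambda>i. s $ i"] by metis
  define x where "x j = (if j < CARD('n) then s $ g j else 0)" for j
  define e where "e = inv_into {..<CARD('n)} g"
  have e: "bij_betw e UNIV {..<CARD('n)}" unfolding e_def by (rule bij_betw_inv_into[OF g])
  have ge: "g (e i) = i" "e i < CARD('n)" for i
    using g e by (auto simp: e_def bij_betw_def f_inv_into_f)
  have sx: "s $ i = x (e i)" for i by (simp add: x_def ge)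
  have x: "antimono x" "0 \<le> x j" for j
    using dec s by (auto simp: x_def antimono_def)
  have "f (singular_values X) = f (\<chi> i. \<bar>s $ i\<bar>)"
    unfolding Xe by (rule symmetric_fun_singular_values[OF f lists_singular_values_rank_one_sum[OF u v]])
  also have "\<dots> = f (\<chi> i. x (e i))" by (simp add: sx x)
  also have "\<dots> = f (\<chi> i. x (index_of i))" by (rule symmetric_fun_reindex[OF f e])
  finally have fx: "f (\<chi> i. x (index_of i)) \<le> 0" using X by (simp add: spectral_rank_set_def)
  \<comment> \<open>A nonzero entry at \<open>j\<close> forces the \<open>j + 1\<close> entries up to \<open>j\<close> to be nonzero.\<close>
  have "x j = 0" if "k \<le> j" for j
  proof (rule ccontr)
    assume "x j \<noteq> 0"
    hence j: "j < CARD('n)" "0 < x j" using x(2)[of j] by (auto simp: x_def split: if_splits)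
    have "g ` {..j} \<subseteq> {i. s $ i \<noteq> 0}"
    proof clarify
      fix i assume "i \<le> j" "s $ g i = 0"
      thus False using dec[of i j] j by (simp add: x_def)
    qed
    hence "card (g ` {..j}) \<le> rank X" unfolding Xe rank_rank_one_sum[OF u v] by (intro card_mono) auto
    moreover have "inj_on g {..j}" using g j by (auto simp: bij_betw_def intro: inj_on_subset)
    ultimately have "Suc j \<le> rank X" by (simp add: card_image)
    thus False using X that by (simp add: spectral_rank_set_def)
  qed
  hence "x \<in> singular_profiles f k" using x fx by (simp add: singular_profiles_def)
  moreover have "ky_fan_dominated X x"
    unfolding Xe by (rule ky_fan_dominated_rank_one_sum[OF u v e sx x])
  ultimately show ?thesis by blast
qed

lemma convex_dominated:
  fixes f :: "real^'n::finite \<Rightarrow> real"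
  assumes f: "convex_on UNIV f"
  shows "convex {X :: real^'p::finite^'n. \<exists>x\<in>singular_profiles f k. ky_fan_dominated X x}"
proof (rule convexI, clarify)
  fix X Y :: "real^'p^'n" and a b :: real and x y
  assume ab: "0 \<le> a" "0 \<le> b" "a + b = 1" and x: "x \<in> singular_profiles f k"
    and y: "y \<in> singular_profiles f k" and X: "ky_fan_dominated X x" and Y: "ky_fan_dominated Y y"
  define z where "z j = a * x j + b * y j" for j
  have "f (a *\<^sub>R (\<chi> i. x (index_of i)) + b *\<^sub>R (\<chi> i. y (index_of i)))
      \<le> a * f (\<chi> i. x (index_of i)) + b * f (\<chi> i. y (index_of i))"
    using f ab unfolding convex_on_def by blast
  also have "\<dots> \<le> 0"
    using x y ab by (auto simp: singular_profiles_def intro!: add_nonpos_nonpos mult_nonneg_nonpos)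
  also have "a *\<^sub>R (\<chi> i. x (index_of i)) + b *\<^sub>R (\<chi> i. y (index_of i)) = (\<chi> i. z (index_of i))"
    by (simp add: z_def vec_eq_iff)
  finally have "f (\<chi> i. z (index_of i)) \<le> 0" .
  moreover have "antimono z"
    using x y ab by (auto simp: z_def singular_profiles_def antimono_def intro!: add_mono mult_left_mono)
  ultimately have "z \<in> singular_profiles f k"
    using x y ab by (auto simp: z_def singular_profiles_def)
  moreover have "ky_fan_dominated (a *\<^sub>R X + b *\<^sub>R Y) z"
    unfolding ky_fan_dominated_def
  proof (intro allI impI)
    fix u :: "'n \<Rightarrow> real^'n" and v :: "'n \<Rightarrow> real^'p" and K :: "'n set"
    assume u: "orthonormal_family u" and v: "orthonormal_family v"
    have "(\<Sum>i\<in>K. u i \<bullet> ((a *\<^sub>R X + b *\<^sub>R Y) *v v i))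
        = a * (\<Sum>i\<in>K. u i \<bullet> (X *v v i)) + b * (\<Sum>i\<in>K. u i \<bullet> (Y *v v i))"
      by (simp add: matrix_vector_mult_add_rdistrib scaleR_matrix_vector_assoc[symmetric] inner_add_right sum.distrib sum_distrib_left)
    also have "\<dots> \<le> a * sum x {..<card K} + b * sum y {..<card K}"
      using X Y u v ab unfolding ky_fan_dominated_def by (intro add_mono mult_left_mono) blast+
    finally show "(\<Sum>i\<in>K. u i \<bullet> ((a *\<^sub>R X + b *\<^sub>R Y) *v v i)) \<le> sum z {..<card K}"
      by (simp add: z_def sum.distrib sum_distrib_left)
  qed
  ultimately show "\<exists>x\<in>singular_profiles f k. ky_fan_dominated (a *\<^sub>R X + b *\<^sub>R Y) x" by blast
qed

lemma hull_dominated: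
  fixes f :: "real^'n::finite \<Rightarrow> real" and X :: "real^'p::finite^'n"
  assumes "CARD('n) \<le> CARD('p)" "symmetric_fun f" "convex_on UNIV f"
    and "X \<in> convex hull (spectral_rank_set f k)"
  obtains x where "x \<in> singular_profiles f k" "ky_fan_dominated X x"
proof -
  have "convex hull (spectral_rank_set f k) \<subseteq>
      {X :: real^'p^'n. \<exists>x\<in>singular_profiles f k. ky_fan_dominated X x}"
    using assms spectral_rank_set_dominated by (intro hull_minimal convex_dominated) auto
  thus ?thesis using assms that by blast
qed

section \<open>Dominated singular values give points of the hull\<close>

text \<open>
The diagonals of matrices with singular values \<open>x\<close> that are diagonal in a given pair of bases.
\<close>

definition signed_rearrangements :: "(nat \<Rightarrow> real) \<Rightarrow> (real^'n::finite) set" where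
  "signed_rearrangements x =
     {\<chi> i. (if i \<in> T then - 1 else 1) * x (e i) | T e. bij_betw e UNIV {..<CARD('n)}}"

lemma finite_signed_rearrangements: "finite (signed_rearrangements x :: (real^'n::finite) set)"
proof -
  let ?E = "PiE (UNIV :: 'n set) (\<lambda>_. {..<CARD('n)})"
  have "(signed_rearrangements x :: (real^'n::finite) set) \<subseteq>
      (\<lambda>(T, e). \<chi> i. (if i \<in> T then - 1 else 1) * x (e i)) ` (UNIV \<times> ?E)"
    unfolding signed_rearrangements_def by (fastforce simp: bij_betw_def)
  moreover have "finite (UNIV \<times> ?E :: ('n set \<times> _) set)" by (intro finite_cartesian_product finite_PiE) auto
  ultimately show ?thesis by (meson finite_imageI finite_subset)
qed

text \<open>
Otherwise a linear functional \<open>c\<close> separates \<open>s\<close> from the hull.  The rearrangement of \<open>x\<close> that is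
best for \<open>c\<close> puts the largest entries of \<open>x\<close> where \<open>\<bar>c\<bar>\<close> is largest, and summation by parts shows
that it does at least as well as \<open>s\<close>.
\<close>

lemma majorized_in_hull:
  fixes s :: "real^'n::finite"
  assumes s: "\<And>i. 0 \<le> s $ i"
    and dom: "\<And>K. (\<Sum>i\<in>K. s $ i) \<le> sum x {..<card K}"
  shows "s \<in> convex hull signed_rearrangements x"
proof (rule ccontr)
  assume "s \<notin> convex hull signed_rearrangements x"
  moreover have "closed (convex hull (signed_rearrangements x :: (real^'n) set))"
    by (intro compact_imp_closed finite_imp_compact_convex_hull finite_signed_rearrangements)
  ultimately obtain c b where cs: "c \<bullet> s < b" and cy: "\<And>y. y \<in> convex hull signed_rearrangements x \<Longrightarrow> b < c \<bullet> y"
    using separating_hyperplane_closed_point[OF convex_convex_hull] by metis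
  obtain g where g: "bij_betw g {..<CARD('n)} UNIV"
    and dec: "\<And>i j. i \<le> j \<Longrightarrow> j < CARD('n) \<Longrightarrow> \<bar>c $ g j\<bar> \<le> \<bar>c $ g i\<bar>"
    using obtain_decreasing_enumeration[of "\<lambda>i. \<bar>c $ i\<bar>"] by metis
  define e where "e = inv_into {..<CARD('n)} g"
  have e: "bij_betw e UNIV {..<CARD('n)}" unfolding e_def by (rule bij_betw_inv_into[OF g])
  have eg: "e (g j) = j" if "j < CARD('n)" for j
    using g that by (simp add: e_def bij_betw_def)
  \<comment> \<open>The functional \<open>c\<close> is smaller at \<open>s\<close> than on the hull, so \<open>y\<close> carries the signs opposite to \<open>c\<close>.\<close>
  define y :: "real^'n" where "y = (\<chi> i. (if i \<in> {i. c $ i \<ge> 0} then - 1 else 1) * x (e i))"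
  have "y \<in> signed_rearrangements x" unfolding y_def signed_rearrangements_def using e by blast
  hence "b < c \<bullet> y" by (intro cy hull_inc)
  have "- (c \<bullet> s) \<le> (\<Sum>i\<in>UNIV. \<bar>c $ i\<bar> * s $ i)"
    unfolding inner_vec_def sum_negf[symmetric]
  proof (rule sum_mono)
    fix i
    have "(- (c $ i)) * s $ i \<le> \<bar>c $ i\<bar> * s $ i" using s[of i] by (intro mult_right_mono) auto
    thus "- (c $ i \<bullet> s $ i) \<le> \<bar>c $ i\<bar> * s $ i" by simp
  qed
  also have "\<dots> = (\<Sum>j<CARD('n). \<bar>c $ g j\<bar> * s $ g j)"
    by (rule sum.reindex_bij_betw[OF g, symmetric])
  also have "\<dots> \<le> (\<Sum>j<CARD('n). \<bar>c $ g j\<bar> * x j)"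
  proof (rule abel_inequality)
    fix l assume "l \<le> CARD('n)"
    hence inj: "inj_on g {..<l}" using g by (auto simp: bij_betw_def intro: inj_on_subset)
    show "(\<Sum>j<l. s $ g j) \<le> sum x {..<l}"
      using dom[of "g ` {..<l}"] by (simp add: sum.reindex[OF inj] card_image[OF inj])
  qed (use dec in auto)
  also have "\<dots> = (\<Sum>j<CARD('n). \<bar>c $ g j\<bar> * x (e (g j)))" by (simp add: eg)
  also have "\<dots> = (\<Sum>i\<in>UNIV. \<bar>c $ i\<bar> * x (e i))"
    by (rule sum.reindex_bij_betw[OF g])
  also have "\<dots> = - (c \<bullet> y)"
    unfolding inner_vec_def sum_negf[symmetric] y_def by (rule sum.cong) auto
  finally show False using \<open>b < c \<bullet> y\<close> cs by linarith
qed

lemma rank_one_sum_in_hull: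
  fixes f :: "real^'n::finite \<Rightarrow> real" and u :: "'n \<Rightarrow> real^'n" and v :: "'n \<Rightarrow> real^'p::finite"
  assumes f: "symmetric_fun f" and x: "x \<in> singular_profiles f k"
    and u: "orthonormal_family u" and v: "orthonormal_family v"
    and s: "\<And>i. 0 \<le> s $ i" and dom: "\<And>K. (\<Sum>i\<in>K. s $ i) \<le> sum x {..<card K}"
  shows "rank_one_sum u v s \<in> convex hull (spectral_rank_set f k)"
proof -
  have "rank_one_sum u v y \<in> spectral_rank_set f k" if "y \<in> signed_rearrangements x" for y
  proof -
    from that obtain T e where e: "bij_betw e UNIV {..<CARD('n)}"
      and y: "y = (\<chi> i. (if i \<in> T then - 1 else 1) * x (e i))"
      unfolding signed_rearrangements_def by blast
    have nz: "{i. y $ i \<noteq> 0} \<subseteq> {i. e i < k}"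
      using x by (auto simp: y singular_profiles_def not_le[symmetric])
    have "card {i. e i < k} \<le> card {..<k}"
      using e by (intro card_inj_on_le[of e]) (auto simp: bij_betw_def intro: inj_on_subset)
    hence "rank (rank_one_sum u v y) \<le> k"
      unfolding rank_rank_one_sum[OF u v] using card_mono[OF _ nz] by simp
    moreover have "f (singular_values (rank_one_sum u v y)) = f (\<chi> i. \<bar>y $ i\<bar>)"
      by (rule symmetric_fun_singular_values[OF f lists_singular_values_rank_one_sum[OF u v]])
    moreover have "(\<chi> i. \<bar>y $ i\<bar>) = (\<chi> i. x (e i))"
      using x by (auto simp: y singular_profiles_def vec_eq_iff)
    ultimately show ?thesis
      using x by (simp add: spectral_rank_set_def symmetric_fun_reindex[OF f e] singular_profiles_def)
  qed
  hence "convex hull (rank_one_sum u v ` signed_rearrangements x) \<subseteq> convex hull (spectral_rank_set f k)"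
    by (intro hull_mono) auto
  moreover have "rank_one_sum u v s \<in> rank_one_sum u v ` (convex hull signed_rearrangements x)"
    by (intro imageI majorized_in_hull s dom)
  ultimately show ?thesis by (auto simp: convex_hull_linear_image[OF linear_rank_one_sum])
qed

section \<open>Perturbations that stay in the hull\<close>

text \<open>
Take a largest tight set with fewer than \<open>k\<close> elements.  For sizes from \<open>k\<close> on, the bound no longer
grows, while a set that misses a positive entry of \<open>s\<close> has a sum strictly below the total.  The gap
between \<open>I\<close> and its complement comes from comparing \<open>I\<close> with \<open>I - {a}\<close> and \<open>insert b I\<close>: the first gives
\<open>s a \<ge> x m\<close> and the second \<open>s b < x (m + 1)\<close>, where \<open>m + 1 = \<bar>I\<bar>\<close>.
\<close>

lemma obtain_tight_set:
  fixes s :: "'n::finite \<Rightarrow> real"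
  assumes k: "1 \<le> k" "k < card {a. s a > 0}" and s: "\<And>a. 0 \<le> s a"
    and x: "antimono x" "\<And>j. k \<le> j \<Longrightarrow> x j = (0::real)"
    and dom: "\<And>K. sum s K \<le> sum x {..<card K}"
  obtains I where "card I < k" "\<And>a b. a \<in> I \<Longrightarrow> b \<notin> I \<Longrightarrow> s b < s a"
    "\<And>K. card I < card K \<Longrightarrow> card K < card {a. s a > 0} \<Longrightarrow> sum s K < sum x {..<card K}"
proof -
  let ?P = "{a. s a > 0}"
  define Tight where "Tight I \<longleftrightarrow> card I < k \<and> sum s I = sum x {..<card I}" for I
  have "Tight {}" using k by (simp add: Tight_def)
  moreover have "\<forall>I. Tight I \<longrightarrow> card I < k" by (simp add: Tight_def)
  ultimately obtain I where I: "Tight I" and max: "\<And>K. Tight K \<Longrightarrow> card K \<le> card I"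
    using ex_has_greatest_nat[of Tight "{}" card k] by blast
  have slack: "sum s K < sum x {..<card K}" if K: "card I < card K" "card K < card ?P" for K
  proof (cases "card K < k")
    case True
    hence "sum s K \<noteq> sum x {..<card K}" using max[of K] K by (auto simp: Tight_def)
    thus ?thesis using dom[of K] by linarith
  next
    case False
    have "\<not> ?P \<subseteq> K" using K card_mono[of K ?P] by auto
    then obtain a where a: "s a > 0" "a \<notin> K" by blast
    have "sum s K < sum s (insert a K)" using a by simp
    also have "\<dots> \<le> sum s UNIV" using s by (intro sum_mono2) auto
    also have "\<dots> \<le> sum x {..<CARD('n)}" by (rule dom)
    also have "\<dots> = sum x {..<card K}"
      using False x(2) by (intro sum.mono_neutral_right) (auto intro: card_mono)
    finally show ?thesis .
  qed
  have cI: "card I < k" "sum s I = sum x {..<card I}" using I by (auto simp: Tight_def)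
  have "s b < s a" if ab: "a \<in> I" "b \<notin> I" for a b
  proof -
    obtain m where m: "card I = Suc m" using ab by (cases "card I") auto
    have "card (I - {a}) = m" using ab m by simp
    moreover have "sum s (I - {a}) = sum s I - s a" using ab by (simp add: sum_diff1)
    ultimately have "x m \<le> s a" using dom[of "I - {a}"] cI m by simp
    moreover have "s b < x (Suc m)"
      using slack[of "insert b I"] ab cI k m by simp
    moreover have "x (Suc m) \<le> x m" using x(1) by (simp add: antimono_def)
    ultimately show ?thesis by linarith
  qed
  with cI slack that show ?thesis by blast
qed

text \<open>
With \<open>H = rank_one_sum u u s\<close>, the matrix \<open>H ** J\<close> has singular values \<open>s\<close>, and the perturbed symmetric
matrix \<open>H + t G\<close> turns out to be positive semidefinite, so that its eigenvalues are the singular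
values of the perturbed product.  They are values of the quadratic form at orthonormal
vectors, and these are estimated through the coefficients in the basis \<open>u\<close>.  The bound on \<open>G\<close> says that \<open>G\<close>
only touches \<open>u i\<close> and \<open>u j\<close> and has size at most one there.
\<close>

lemma perturbed_in_hull:
  fixes f :: "real^'n::finite \<Rightarrow> real" and u :: "'n \<Rightarrow> real^'n" and J :: "real^'p::finite^'n"
    and s :: "real^'n"
  assumes f: "symmetric_fun f" and x: "x \<in> singular_profiles f k"
    and u: "orthonormal_family u" and J: "J ** transpose J = mat 1"
    and s: "\<And>a. 0 \<le> s $ a" and dom: "\<And>K. (\<Sum>a\<in>K. s $ a) \<le> sum x {..<card K}"
    and slack: "\<And>K. card I < card K \<Longrightarrow> card K < card {a. s $ a > 0} \<Longrightarrow>
      (\<Sum>a\<in>K. s $ a) < sum x {..<card K}"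
    and gap: "\<And>a b. a \<in> I \<Longrightarrow> b \<notin> I \<Longrightarrow> s $ b < s $ a"
    and ij: "i \<notin> I" "j \<notin> I" "i \<noteq> j" "s $ i > 0" "s $ j > 0"
  obtains t where "t > 0" "\<And>G. transpose G = G \<Longrightarrow> trace G = 0 \<Longrightarrow>
      (\<And>w. \<bar>w \<bullet> (G *v w)\<bar> \<le> (u i \<bullet> w)\<^sup>2 + (u j \<bullet> w)\<^sup>2) \<Longrightarrow>
      (rank_one_sum u u s + t *\<^sub>R G) ** J \<in> convex hull (spectral_rank_set f k)"
proof -
  let ?P = "{a. s $ a > 0}"
  \<comment> \<open>All strict inequalities that the perturbation must respect have their margins in \<open>M\<close>.  A third
    of the smallest margin suffices, because sums change by at most \<open>2 * t\<close> and differences by \<open>t\<close>.\<close>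
  define M where "M = {s $ i, s $ j} \<union> (\<lambda>(a, b). s $ a - s $ b) ` (I \<times> (- I)) \<union>
    (\<lambda>K. sum x {..<card K} - (\<Sum>a\<in>K. s $ a)) ` {K. card I < card K \<and> card K < card ?P}"
  define t where "t = Min M / 3"
  have M: "finite M" "M \<noteq> {}" by (auto simp: M_def)
  have "\<forall>y\<in>M. 0 < y" using slack gap ij by (auto simp: M_def)
  hence t: "t > 0" using M by (simp add: t_def)
  have tM: "3 * t \<le> y" if "y \<in> M" for y using M that by (simp add: t_def)
  have t_ij: "3 * t \<le> s $ i" "3 * t \<le> s $ j" by (rule tM, simp add: M_def)+
  have t_gap: "3 * t \<le> s $ a - s $ b" if "a \<in> I" "b \<notin> I" for a b
    using that by (intro tM) (auto simp: M_def)
  have t_slack: "3 * t \<le> sum x {..<card K} - (\<Sum>a\<in>K. s $ a)"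
    if "card I < card K" "card K < card ?P" for K
    using that by (intro tM) (auto simp: M_def)
  \<comment> \<open>The perturbed quadratic form lies below the diagonal form with coefficients \<open>c\<close>.\<close>
  define c where "c a = s $ a + (if a \<in> {i, j} then t else 0)" for a
  show ?thesis
  proof (rule that[OF t])
    fix G :: "real^'n^'n"
    assume G: "transpose G = G" "trace G = 0"
      and bound: "\<And>w. \<bar>w \<bullet> (G *v w)\<bar> \<le> (u i \<bullet> w)\<^sup>2 + (u j \<bullet> w)\<^sup>2"
    define H where "H = rank_one_sum u u s + t *\<^sub>R G"
    have "transpose H = H"
      using G(1) transpose_rank_one_sum[of u u s] by (simp add: H_def vec_eq_iff transpose_def)
    then obtain w :: "'n \<Rightarrow> real^'n" and \<mu> :: "real^'n" where w: "orthonormal_family w" and Hw: "H = rank_one_sum w w \<mu>"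
      by (rule spectral_decomposition)
    have quad: "y \<bullet> (H *v y) = (\<Sum>a\<in>UNIV. s $ a * (u a \<bullet> y)\<^sup>2) + t * (y \<bullet> (G *v y))" for y
      by (simp add: H_def matrix_vector_mult_add_rdistrib scaleR_matrix_vector_assoc[symmetric]
          inner_add_right inner_rank_one_sum_mult power2_eq_square)
    have on_ij: "(\<Sum>a\<in>UNIV. (if a \<in> {i, j} then t else 0) * (u a \<bullet> y)\<^sup>2) = t * ((u i \<bullet> y)\<^sup>2 + (u j \<bullet> y)\<^sup>2)" for y
    proof -
      have "(\<Sum>a\<in>UNIV. (if a \<in> {i, j} then t else 0) * (u a \<bullet> y)\<^sup>2)
          = (\<Sum>a\<in>UNIV. if a \<in> {i, j} then t * (u a \<bullet> y)\<^sup>2 else 0)"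
        by (rule sum.cong) auto
      also have "\<dots> = (\<Sum>a\<in>{i, j}. t * (u a \<bullet> y)\<^sup>2)"
        by (subst sum.inter_restrict[symmetric]) auto
      finally show ?thesis using ij by (simp add: distrib_left)
    qed
    have abs_bound: "\<bar>t * (y \<bullet> (G *v y))\<bar> \<le> (\<Sum>a\<in>UNIV. (if a \<in> {i, j} then t else 0) * (u a \<bullet> y)\<^sup>2)" for y
      using t bound[of y] unfolding on_ij by (simp add: abs_mult)
    have upper: "y \<bullet> (H *v y) \<le> (\<Sum>a\<in>UNIV. c a * (u a \<bullet> y)\<^sup>2)" for y
      using abs_bound[of y] unfolding quad c_def by (simp only: distrib_right sum.distrib)
    have lower: "0 \<le> y \<bullet> (H *v y)" for y
    proof -
      have "(\<Sum>a\<in>UNIV. (if a \<in> {i, j} then t else 0) * (u a \<bullet> y)\<^sup>2) \<le> (\<Sum>a\<in>UNIV. s $ a * (u a \<bullet> y)\<^sup>2)"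
        using t t_ij s by (intro sum_mono mult_right_mono) auto
      thus ?thesis using abs_bound[of y] unfolding quad by linarith
    qed
    have \<mu>: "\<mu> $ q = w q \<bullet> (H *v w q)" for q
      unfolding Hw by (rule orthonormal_family_diagonal[OF w w, symmetric])
    have \<mu>0: "0 \<le> \<mu> $ q" for q unfolding \<mu> by (rule lower)
    have x0: "0 \<le> x l" for l using x by (simp add: singular_profiles_def)
    have "(\<Sum>q\<in>K. \<mu> $ q) \<le> sum x {..<card K}" for K
    proof (cases "card K < card ?P")
      case True
      define p where "p a = (\<Sum>q\<in>K. (u a \<bullet> w q)\<^sup>2)" for a
      have p0: "0 \<le> p a" for a by (auto simp: p_def intro: sum_nonneg)
      have p1: "p a \<le> 1" for a
        using bessel_inequality[OF w, of K "u a"] by (simp add: p_def inner_commute orthonormal_familyD[OF u])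
      have "sum p UNIV = (\<Sum>q\<in>K. \<Sum>a\<in>UNIV. (u a \<bullet> w q)\<^sup>2)" unfolding p_def by (rule sum.swap)
      hence ps: "sum p UNIV \<le> card K"
        by (simp add: orthonormal_family_parseval[OF u] orthonormal_familyD[OF w])
      have c0: "0 \<le> c a" for a using s t by (simp add: c_def)
      have "card K \<le> CARD('n)" by (intro card_mono) auto
      then obtain K' where K': "card K' = card K" "\<And>a b. a \<in> K' \<Longrightarrow> b \<notin> K' \<Longrightarrow> c b \<le> c a"
        "(\<Sum>a\<in>UNIV. c a * p a) \<le> sum c K'"
        using c0 p0 p1 ps by (rule weighted_sum_le_some_sum[where c = c and p = p]) blast
      have "(\<Sum>q\<in>K. \<mu> $ q) \<le> (\<Sum>q\<in>K. \<Sum>a\<in>UNIV. c a * (u a \<bullet> w q)\<^sup>2)"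
        unfolding \<mu> by (intro sum_mono upper)
      also have "\<dots> = (\<Sum>a\<in>UNIV. c a * p a)"
        unfolding p_def sum_distrib_left by (rule sum.swap)
      also have "\<dots> \<le> sum c K'" by (rule K')
      also have "\<dots> \<le> sum x {..<card K'}"
      proof (cases "card I < card K'")
        case big: True
        have "sum c K' \<le> (\<Sum>a\<in>K'. s $ a) + (\<Sum>a\<in>UNIV. if a \<in> {i, j} then t else 0)"
          unfolding c_def sum.distrib using t by (intro add_left_mono sum_mono2) auto
        also have "(\<Sum>a\<in>UNIV. if a \<in> {i, j} then t else 0) = 2 * t"
          using ij by (subst sum.inter_restrict[symmetric]) auto
        finally show ?thesis using t_slack[of K'] big True K'(1) t by simp
      next
        case small: False
        \<comment> \<open>The gap keeps the largest coefficients \<open>c\<close> inside \<open>I\<close>, where they agree with \<open>s\<close>.\<close>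
        have "K' \<subseteq> I"
        proof (rule ccontr)
          assume "\<not> K' \<subseteq> I"
          then obtain b where b: "b \<in> K'" "b \<notin> I" by blast
          have "\<not> I \<subseteq> K'"
            using b small psubset_card_mono[of K' I] by auto
          then obtain a where a: "a \<in> I" "a \<notin> K'" by blast
          show False using K'(2)[OF b(1) a(2)] t_gap[OF a(1) b(2)] t ij a(1)
            by (auto simp: c_def split: if_splits)
        qed
        hence "sum c K' = (\<Sum>a\<in>K'. s $ a)" using ij by (intro sum.cong) (auto simp: c_def)
        thus ?thesis using dom by simp
      qed
      finally show ?thesis by (simp add: K')
    next
      case False
      \<comment> \<open>For large \<open>K\<close> only the total matters, and it is a trace, to which \<open>G\<close> does not contribute.\<close>
      have "(\<Sum>q\<in>K. \<mu> $ q) \<le> (\<Sum>q\<in>UNIV. \<mu> $ q)" using \<mu>0 by (intro sum_mono2) auto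
      also have "\<dots> = trace H" by (simp add: Hw orthonormal_family_trace[OF w])
      also have "\<dots> = (\<Sum>a\<in>UNIV. s $ a) + t * trace G"
        unfolding orthonormal_family_trace[OF u, symmetric]
        by (simp add: H_def trace_def sum.distrib sum_distrib_left)
      also have "\<dots> = (\<Sum>a\<in>?P. s $ a)"
        using G s by (simp add: sum.mono_neutral_right[of UNIV ?P] less_le)
      also have "\<dots> \<le> sum x {..<card ?P}" by (rule dom)
      also have "\<dots> \<le> sum x {..<card K}" using False x0 by (intro sum_mono2) auto
      finally show ?thesis .
    qed
    moreover have "orthonormal_family (\<lambda>q. transpose J *v w q)"
    proof -
      have "(transpose J *v a) \<bullet> (transpose J *v b) = a \<bullet> b" for a b
      proof -
        have "(transpose J *v a) \<bullet> (transpose J *v b) = a \<bullet> ((J ** transpose J) *v b)"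
          by (simp only: matrix_vector_mul_assoc[symmetric] dot_lmul_matrix[symmetric] transpose_matrix_vector)
        thus ?thesis by (simp add: J)
      qed
      thus ?thesis using w by (simp add: orthonormal_family_def)
    qed
    ultimately show "(rank_one_sum u u s + t *\<^sub>R G) ** J \<in> convex hull (spectral_rank_set f k)"
      unfolding H_def[symmetric] Hw rank_one_sum_mult_matrix by (intro rank_one_sum_in_hull[OF f x w]) (auto intro: \<mu>0)
  qed
qed

section \<open>Counting directions of a face\<close>

definition outer_product :: "real^'m::finite \<Rightarrow> real^'p::finite \<Rightarrow> real^'p^'m" where
  "outer_product a b = (\<chi> i j. a $ i * b $ j)"

lemma inner_outer_product: "outer_product a b \<bullet> outer_product c d = (a \<bullet> c) * (b \<bullet> d)"
proof -
  have "outer_product a b \<bullet> outer_product c d = (\<Sum>i\<in>UNIV. \<Sum>j\<in>UNIV. (a $ i * c $ i) * (b $ j * d $ j))"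
    by (simp add: outer_product_def inner_vec_def mult_ac)
  also have "\<dots> = (a \<bullet> c) * (b \<bullet> d)" unfolding inner_vec_def inner_real_def by (rule sum_product[symmetric])
  finally show ?thesis .
qed

lemma outer_product_mult_vector: "outer_product a b *v w = (b \<bullet> w) *\<^sub>R a"
  by (simp add: outer_product_def vec_eq_iff matrix_vector_mult_def inner_vec_def sum_distrib_left mult_ac)

lemma outer_product_mult_matrix: "outer_product a b ** J = outer_product a (transpose J *v b)"
  by (simp add: outer_product_def vec_eq_iff matrix_matrix_mult_def matrix_vector_mult_def
      transpose_def sum_distrib_left mult_ac)

lemma trace_outer_product: "trace (outer_product a b) = a \<bullet> b"
  by (simp add: outer_product_def trace_def inner_vec_def)

lemma card_ordered_pairs:
  fixes B :: "'a set" and h :: "'a \<Rightarrow> nat"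
  assumes "finite B" "inj_on h B"
  shows "2 * card {(a, b). a \<in> B \<and> b \<in> B \<and> h a \<le> h b} = card B * (card B + 1)"
proof -
  let ?T = "{(a, b). a \<in> B \<and> b \<in> B \<and> h a \<le> h b}"
  have sub: "?T \<subseteq> B \<times> B" by auto
  hence fin: "finite ?T" using assms(1) finite_subset by blast
  have "card (prod.swap ` ?T) = card ?T" by (intro card_image) auto
  moreover have "?T \<union> prod.swap ` ?T = B \<times> B" by (auto simp: image_iff)
  moreover have "?T \<inter> prod.swap ` ?T = (\<lambda>a. (a, a)) ` B"
    using assms(2) by (auto simp: inj_on_def)
  moreover have "card ((\<lambda>a. (a, a)) ` B) = card B" by (intro card_image inj_onI) simp
  ultimately show ?thesis
    using card_Un_Int[OF fin, of "prod.swap ` ?T"] fin by (simp add: card_cartesian_product)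
qed

text \<open>
The symmetrized products indexed by unordered pairs from \<open>B\<close> are nonzero and pairwise orthogonal
in the Frobenius inner product.
\<close>

lemma symmetrized_products_dimension:
  fixes u :: "'n::finite \<Rightarrow> real^'m::finite" and v :: "'n \<Rightarrow> real^'p::finite"
  assumes u: "orthonormal_family u" and v: "orthonormal_family v"
    and mem: "\<And>a b. a \<in> B \<Longrightarrow> b \<in> B \<Longrightarrow> outer_product (u a) (v b) + outer_product (u b) (v a) \<in> S"
  shows "card B * (card B + 1) \<le> 2 * dim S"
proof -
  define T where "T = {(a, b). a \<in> B \<and> b \<in> B \<and> (index_of a :: nat) \<le> index_of b}"
  define E where "E = (\<lambda>(a, b). outer_product (u a) (v b) + outer_product (u b) (v a))"
  have inj: "inj (index_of :: 'n \<Rightarrow> nat)" using bij_betw_index_of[where 'n='n] by (simp add: bij_betw_def)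
  have ip: "E (a, b) \<bullet> E (c, d) = (if a = c \<and> b = d then 2 else 0) + (if a = d \<and> b = c then 2 else 0)" for a b c d
  proof -
    have "E (a, b) \<bullet> E (c, d) = (u a \<bullet> u c) * (v b \<bullet> v d) + (u a \<bullet> u d) * (v b \<bullet> v c)
        + (u b \<bullet> u c) * (v a \<bullet> v d) + (u b \<bullet> u d) * (v a \<bullet> v c)"
      by (simp add: E_def inner_add_left inner_add_right inner_outer_product)
    thus ?thesis
      unfolding orthonormal_familyD[OF u] orthonormal_familyD[OF v]
      by (cases "a = c"; cases "b = d"; cases "a = d"; cases "b = c") simp_all
  qed
  have orth: "E p \<bullet> E q = 0" if "p \<in> T" "q \<in> T" "p \<noteq> q" for p q
  proof -
    obtain a b c d where pq: "p = (a, b)" "q = (c, d)" by (cases p; cases q)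
    have "\<not> (a = d \<and> b = c)"
    proof
      assume "a = d \<and> b = c"
      hence "(index_of a :: nat) = index_of b" using that pq by (simp add: T_def)
      hence "a = b" by (rule injD[OF inj])
      thus False using \<open>a = d \<and> b = c\<close> that pq by simp
    qed
    moreover have "\<not> (a = c \<and> b = d)" using that(3) pq by blast
    ultimately show ?thesis unfolding pq ip by (simp only: if_False add_0)
  qed
  have nz: "E p \<bullet> E p \<noteq> 0" for p by (cases p) (simp add: ip)
  have "inj_on E T"
  proof (rule inj_onI)
    fix p q assume "p \<in> T" "q \<in> T" "E p = E q"
    thus "p = q" using orth[of p q] nz[of p] by metis
  qed
  hence "card (E ` T) = card T" by (rule card_image)
  moreover have "independent (E ` T)"
  proof (rule pairwise_orthogonal_independent)
    show "pairwise orthogonal (E ` T)"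
    proof (rule pairwiseI)
      fix y z assume "y \<in> E ` T" "z \<in> E ` T" "y \<noteq> z"
      then obtain p q where "p \<in> T" "q \<in> T" "y = E p" "z = E q" "p \<noteq> q" by blast
      thus "orthogonal y z" unfolding orthogonal_def using orth[of p q] by metis
    qed
    show "0 \<notin> E ` T"
    proof
      assume "0 \<in> E ` T"
      then obtain p where "0 = E p" by (rule imageE)
      with nz[of p] show False by (metis inner_zero_left)
    qed
  qed
  moreover have "E ` T \<subseteq> S"
  proof (rule image_subsetI)
    fix p assume "p \<in> T"
    thus "E p \<in> S" using mem[of "fst p" "snd p"] by (cases p) (simp add: E_def T_def)
  qed
  ultimately have "card T \<le> dim S" using independent_card_le_dim by metis
  thus ?thesis using card_ordered_pairs[of B index_of] inj_on_subset[OF inj, of B] by (simp add: T_def)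
qed

lemma face_direction:
  assumes F: "F face_of C" and X: "X \<in> F" and t: "t > 0"
    and plus: "X + t *\<^sub>R E \<in> C" and minus: "X - t *\<^sub>R E \<in> C"
  shows "E \<in> span ((+) (- X) ` F)"
proof (cases "E = 0")
  case False
  have "midpoint (X - t *\<^sub>R E) (X + t *\<^sub>R E) = X"
    by (simp add: midpoint_def scaleR_2[symmetric])
  moreover have "X - t *\<^sub>R E \<noteq> X + t *\<^sub>R E"
  proof
    assume "X - t *\<^sub>R E = X + t *\<^sub>R E"
    hence "(2 * t) *\<^sub>R E = 0" by (simp add: algebra_simps scaleR_2[symmetric])
    thus False using t False by simp
  qed
  ultimately have "X \<in> open_segment (X - t *\<^sub>R E) (X + t *\<^sub>R E)"
    by (metis midpoint_in_open_segment)
  hence "X + t *\<^sub>R E \<in> F" using F plus minus X unfolding face_of_def by blast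
  hence "t *\<^sub>R E \<in> span ((+) (- X) ` F)" by (intro span_base image_eqI[of _ _ "X + t *\<^sub>R E"]) auto
  hence "(1 / t) *\<^sub>R (t *\<^sub>R E) \<in> span ((+) (- X) ` F)" by (rule span_scale)
  thus ?thesis using t by simp
qed (simp add: span_zero)

text \<open>
The block \<open>B\<close> contributes the symmetric directions \<open>u a v b\<^sup>T + u b v a\<^sup>T\<close> and the differences of
\<open>u a v a\<^sup>T\<close>.  Together with the single further direction \<open>Z\<close> they span all symmetrized products,
which is why the count loses exactly one for the trace condition.
\<close>

lemma face_dimension_lower_bound:
  fixes f :: "real^'n::finite \<Rightarrow> real" and X :: "real^'p::finite^'n"
  assumes np: "CARD('n) \<le> CARD('p)" and f: "symmetric_fun f" "convex_on UNIV f"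
    and k: "1 \<le> k" "k < rank X"
    and F: "F face_of (convex hull (spectral_rank_set f k))" and X: "X \<in> F"
    and d: "aff_dim F = int d"
  shows "(rank X - k + 1) * (rank X - k + 2) \<le> 2 * (d + 1)"
proof -
  let ?C = "convex hull (spectral_rank_set f k) :: (real^'p^'n) set"
  have "X \<in> ?C" using F X face_of_imp_subset by blast
  then obtain x where x: "x \<in> singular_profiles f k" and Xx: "ky_fan_dominated X x"
    using hull_dominated[OF np f] by metis
  obtain u :: "'n \<Rightarrow> real^'n" and v :: "'n \<Rightarrow> real^'p" and s :: "real^'n"
    where u: "orthonormal_family u" and v: "orthonormal_family v" and s: "\<And>i. 0 \<le> s $ i"
      and Xe: "X = rank_one_sum u v s"
    using singular_value_decomposition[OF np, of X] by metis
  let ?P = "{a. s $ a > 0}"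
  have P: "rank X = card ?P" unfolding Xe rank_rank_one_sum[OF u v] using s by (simp add: less_le)
  have dom: "(\<Sum>i\<in>K. s $ i) \<le> sum x {..<card K}" for K
    using Xx u v unfolding ky_fan_dominated_def
    by (metis (no_types, lifting) Xe orthonormal_family_diagonal sum.cong)
  obtain I where I: "card I < k" and gap: "\<And>a b. a \<in> I \<Longrightarrow> b \<notin> I \<Longrightarrow> s $ b < s $ a"
    and slack: "\<And>K. card I < card K \<Longrightarrow> card K < card ?P \<Longrightarrow> (\<Sum>a\<in>K. s $ a) < sum x {..<card K}"
    using obtain_tight_set[of k "\<lambda>a. s $ a" x] k P s x dom by (auto simp: singular_profiles_def)
  \<comment> \<open>Polar decomposition: \<open>J\<close> is a coisometry whose transpose maps \<open>u i\<close> to \<open>v i\<close>.\<close>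
  define J where "J = rank_one_sum u v 1"
  have J: "J ** transpose J = mat 1"
  proof -
    have "(\<chi> i. (1 $ i)\<^sup>2) = (1 :: real^'n)" by (simp add: vec_eq_iff)
    thus ?thesis
      unfolding J_def rank_one_sum_gram[OF v] by (simp only: orthonormal_family_resolution_of_identity[OF u])
  qed
  have Ju: "transpose J *v u i = v i" for i
    by (simp add: J_def transpose_rank_one_sum rank_one_sum_mult_basis[OF u])
  have XJ: "X = rank_one_sum u u s ** J" by (simp only: Xe rank_one_sum_mult_matrix Ju)
  let ?W = "(+) (- X) ` F"
  let ?B = "?P - I"
  have dir: "G ** J \<in> span ?W"
    if ij: "i \<in> ?B" "j \<in> ?B" "i \<noteq> j" and G: "transpose G = G" "trace G = 0"
      and bound: "\<And>w. \<bar>w \<bullet> (G *v w)\<bar> \<le> (u i \<bullet> w)\<^sup>2 + (u j \<bullet> w)\<^sup>2" for i j G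
  proof -
    obtain t where t: "t > 0" and tG: "\<And>G. transpose G = G \<Longrightarrow> trace G = 0 \<Longrightarrow>
      (\<And>w. \<bar>w \<bullet> (G *v w)\<bar> \<le> (u i \<bullet> w)\<^sup>2 + (u j \<bullet> w)\<^sup>2) \<Longrightarrow> (rank_one_sum u u s + t *\<^sub>R G) ** J \<in> ?C"
      using ij by (auto intro: perturbed_in_hull[where i = i and j = j, OF f(1) x u J s dom slack gap])
    have lin: "(A + t *\<^sub>R G') ** J = A ** J + t *\<^sub>R (G' ** J)" for A G' :: "real^'n^'n"
      by (simp add: vec_eq_iff matrix_matrix_mult_def sum.distrib sum_distrib_left algebra_simps)
    have neg: "(- G) ** J = - (G ** J)"
      by (simp add: vec_eq_iff matrix_matrix_mult_def sum_negf)
    have "X + t *\<^sub>R (G ** J) \<in> ?C" using tG[OF G bound] by (simp add: lin XJ)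
    moreover have "(rank_one_sum u u s + t *\<^sub>R (- G)) ** J \<in> ?C"
    proof (rule tG)
      show "transpose (- G) = - G" using G(1) by (simp add: transpose_def vec_eq_iff)
      show "trace (- G) = 0" using G(2) by (simp add: trace_def sum_negf)
      show "\<bar>w \<bullet> (- G *v w)\<bar> \<le> (u i \<bullet> w)\<^sup>2 + (u j \<bullet> w)\<^sup>2" for w
        using bound[of w] by (simp add: matrix_vector_mult_def inner_vec_def sum_negf)
    qed
    hence "X - t *\<^sub>R (G ** J) \<in> ?C" unfolding lin neg by (simp add: XJ)
    ultimately show ?thesis by (rule face_direction[OF F X t])
  qed
  have off: "outer_product (u a) (v b) + outer_product (u b) (v a) \<in> span ?W"
    if "a \<in> ?B" "b \<in> ?B" "a \<noteq> b" for a b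
  proof -
    let ?G = "outer_product (u a) (u b) + outer_product (u b) (u a)"
    have "?G ** J \<in> span ?W"
    proof (rule dir[OF that])
      show "transpose ?G = ?G"
        by (simp add: outer_product_def transpose_def vec_eq_iff mult.commute)
      show "trace ?G = 0"
        using that by (simp add: trace_add trace_outer_product orthonormal_familyD[OF u])
      show "\<bar>w \<bullet> (?G *v w)\<bar> \<le> (u a \<bullet> w)\<^sup>2 + (u b \<bullet> w)\<^sup>2" for w
        using sum_squares_bound[of "\<bar>u a \<bullet> w\<bar>" "\<bar>u b \<bullet> w\<bar>"]
        by (simp add: matrix_vector_mult_add_rdistrib outer_product_mult_vector inner_add_right
            inner_commute abs_mult mult_ac)
    qed
    moreover have "?G ** J = outer_product (u a) (u b) ** J + outer_product (u b) (u a) ** J"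
      by (simp add: vec_eq_iff matrix_matrix_mult_def sum.distrib distrib_right)
    ultimately show ?thesis by (simp only: outer_product_mult_matrix Ju)
  qed
  have diag: "outer_product (u a) (v a) - outer_product (u b) (v b) \<in> span ?W"
    if "a \<in> ?B" "b \<in> ?B" for a b
  proof (cases "a = b")
    case False
    let ?G = "outer_product (u a) (u a) - outer_product (u b) (u b)"
    have "?G ** J \<in> span ?W"
    proof (rule dir[OF that False])
      show "transpose ?G = ?G"
        by (simp add: outer_product_def transpose_def vec_eq_iff mult.commute)
      show "trace ?G = 0"
        by (simp add: trace_sub trace_outer_product orthonormal_familyD[OF u])
      show "\<bar>w \<bullet> (?G *v w)\<bar> \<le> (u a \<bullet> w)\<^sup>2 + (u b \<bullet> w)\<^sup>2" for w
      proof -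
        have "w \<bullet> (?G *v w) = (u a \<bullet> w)\<^sup>2 - (u b \<bullet> w)\<^sup>2"
          by (simp add: matrix_vector_mult_diff_rdistrib outer_product_mult_vector inner_diff_right
              inner_commute power2_eq_square)
        thus ?thesis using abs_triangle_ineq4[of "(u a \<bullet> w)\<^sup>2" "(u b \<bullet> w)\<^sup>2"] by simp
      qed
    qed
    moreover have "?G ** J = outer_product (u a) (u a) ** J - outer_product (u b) (u b) ** J"
      by (simp add: vec_eq_iff matrix_matrix_mult_def sum_subtractf left_diff_distrib)
    ultimately show ?thesis by (simp only: outer_product_mult_matrix Ju)
  qed (simp add: span_zero)
  have cB: "rank X - k + 1 \<le> card ?B"
    using I k P diff_card_le_card_Diff[of I ?P] by simp
  then obtain i0 where i0: "i0 \<in> ?B" using card_gt_0_iff[of ?B] by fastforce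
  define Z where "Z = outer_product (u i0) (v i0)"
  have "card ?B * (card ?B + 1) \<le> 2 * dim (span (insert Z ?W))"
  proof (rule symmetrized_products_dimension[OF u v])
    fix a b assume ab: "a \<in> ?B" "b \<in> ?B"
    have W: "span ?W \<subseteq> span (insert Z ?W)" by (intro span_mono) auto
    show "outer_product (u a) (v b) + outer_product (u b) (v a) \<in> span (insert Z ?W)"
    proof (cases "a = b")
      case True
      have "(outer_product (u a) (v a) - Z) + Z \<in> span (insert Z ?W)"
        using diag[OF ab(1) i0] W by (intro span_add span_base[of Z]) (auto simp: Z_def)
      hence "outer_product (u a) (v a) \<in> span (insert Z ?W)" by simp
      from span_add[OF this this] show ?thesis using True by simp
    qed (use off[OF ab] W in blast)
  qed
  also have "dim (span (insert Z ?W)) \<le> dim ?W + 1" by (simp add: dim_insert)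
  also have "dim ?W = d"
    using d aff_dim_eq_dim[of X F] X by (simp add: hull_inc)
  finally have "card ?B * (card ?B + 1) \<le> 2 * (d + 1)" by simp
  moreover have "(rank X - k + 1) * (rank X - k + 2) \<le> card ?B * (card ?B + 1)"
    using cB by (intro mult_le_mono) auto
  ultimately show ?thesis by linarith
qed

section \<open>The rank bound\<close>

theorem theorem3:
  fixes f :: "real^'n::finite \<Rightarrow> real"
    and k d :: nat
    and F :: "(real^'p::finite^'n) set"
  assumes "1 \<le> k" and "k \<le> CARD('n)" and "CARD('n) \<le> CARD('p)"
    and "continuous_on UNIV f" and "convex_on UNIV f"
    and "symmetric_fun f" and "sign_invariant f"
    and "F face_of (convex hull (spectral_rank_set f k))"
    and "aff_dim F = int d"
  shows "\<forall>X\<in>F. int (rank X) \<le>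
           int (strengthened_rank TYPE('p) f k) + \<lfloor>sqrt (2 * real d + 9 / 4) - 3 / 2\<rfloor>"
proof
  fix X assume X: "X \<in> F"
  define k' where "k' = strengthened_rank TYPE('p) f k"
  have k': "1 \<le> k' \<and> k' \<le> k \<and> convex hull (spectral_rank_set f k :: (real^'p^'n) set)
      = convex hull (spectral_rank_set f k')"
    unfolding k'_def strengthened_rank_def by (rule LeastI[of _ k]) (use assms(1) in simp)
  have F: "F face_of (convex hull (spectral_rank_set f k'))" using assms(8) k' by simp
  have "real (rank X) - real k' \<le> sqrt (2 * real d + 9 / 4) - 3 / 2"
  proof (cases "k' < rank X")
    case True
    define r where "r = rank X - k'"
    have "(r + 1) * (r + 2) \<le> 2 * (d + 1)" unfolding r_def
      using k' by (intro face_dimension_lower_bound[OF assms(3,6,5) _ True F X assms(9)]) simp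
    hence "real ((r + 1) * (r + 2)) \<le> real (2 * (d + 1))" by (simp only: of_nat_le_iff)
    \<comment> \<open>Completing the square in \<open>r * (r + 3) \<le> 2 * d\<close>.\<close>
    hence "(real r + 3 / 2)\<^sup>2 \<le> 2 * real d + 9 / 4"
      by (simp add: power2_eq_square algebra_simps)
    hence "real r + 3 / 2 \<le> sqrt (2 * real d + 9 / 4)" by (rule real_le_rsqrt)
    thus ?thesis using True by (simp add: r_def of_nat_diff)
  next
    case False
    have "3 / 2 \<le> sqrt (2 * real d + 9 / 4)" by (rule real_le_rsqrt) (simp add: power2_eq_square)
    thus ?thesis using False by simp
  qed
  hence "int (rank X) - int k' \<le> \<lfloor>sqrt (2 * real d + 9 / 4) - 3 / 2\<rfloor>"
    by (simp add: le_floor_iff)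
  thus "int (rank X) \<le> int (strengthened_rank TYPE('p) f k) + \<lfloor>sqrt (2 * real d + 9 / 4) - 3 / 2\<rfloor>"
    by (simp add: k'_def)
qed

end
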